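(* Suppose the attachment rule $f$ is concave. Then the following dichotomy holds. Strong preference: if $\sum_{k=0}^\infty \frac1{f(k)^2}<\infty$, then with probability one there exists a persistent hub, i.e. there is a single vertex which has maximal indegree for all but finitely many times. Weak preference: if $\sum_{k=0}^\infty\frac1{f(k)^2}=\infty$, then with probability one there exists no persistent hub, and the time of birth, or index, of the current hub tends to infinity in probability (as time tends to infinity).
   Context: $\mathbb Z_+=\{0,1,2,\dots\}$. An attachment rule is a monotonically increasing (nondecreasing) function $f:\mathbb Z_+\to(0,\infty)$ with $f(n)\le n+1$ for all $n\in\mathbb Z_+$; concavity means that $k\mapsto f(k+1)-f(k)$ is nonincreasing on $\mathbb Z_+$. The network evolves as follows: at time $n=1$ it consists of a single vertex, labelled $1$, without edges. In the step $n\to n+1$ a new vertex labelled $n+1$ is added and, independently for each old vertex $m\in\{1,\dots,n\}$ (given the graph at time $n$), a directed edge $n+1\to m$ is inserted with probability $f(\text{indegree of } m \text{ at time } n)/n$. The current hub at time $n$ is the vertex of maximal indegree among $\{1,\dots,n\}$ at time $n$ (ties broken by an arbitrary fixed rule), and its index is its label. A vertex has maximal indegree at time $n$ if its indegree at time $n$ equals the maximum of the indegrees of all vertices at time $n$. *)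

theory Defs
  imports "HOL-Probability.Probability" "Graph_Theory.Pair_Digraph"
begin

definition attachment_rule :: "(nat \<Rightarrow> real) \<Rightarrow> bool" where
  "attachment_rule f \<longleftrightarrow> mono f \<and> (\<forall>n. 0 < f n) \<and> (\<forall>n. f n \<le> real n + 1)"

definition concave_rule :: "(nat \<Rightarrow> real) \<Rightarrow> bool" where
  "concave_rule f \<longleftrightarrow> antimono (\<lambda>k. f (Suc k) - f k)"

text \<open>
  An arc is a pair (tail, head); \<open>in_degree\<close> counts the arcs with a given head.
  \<open>add_vertex n S H\<close> joins the new vertex \<open>n + 1\<close> by arcs to all vertices in \<open>S\<close>.
\<close>

definition initial_graph :: "nat pair_pre_digraph" where
  "initial_graph = \<lparr> pverts = {1}, parcs = {} \<rparr>"

definition add_vertex :: "nat \<Rightarrow> nat set \<Rightarrow> nat pair_pre_digraph \<Rightarrow> nat pair_pre_digraph" where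
  "add_vertex n S H =
     \<lparr> pverts = insert (Suc n) (pverts H), parcs = parcs H \<union> {Suc n} \<times> S \<rparr>"

text \<open>
  The law of the graph at time \<open>n + 1\<close> given that the graph at time \<open>n\<close> is \<open>H\<close>:
  \<open>Pi_pmf\<close> is the law of independent indicators, one for each old vertex. For a graph \<open>H\<close> that
  occurs at time \<open>n\<close> with positive probability, an indegree is at most \<open>n - 1\<close>, so that
  the bound on an attachment rule makes each parameter a probability; for other
  graphs \<open>bernoulli_pmf\<close> clips its parameter, but this case is never used.
\<close>

definition attachment_step ::
    "(nat \<Rightarrow> real) \<Rightarrow> nat \<Rightarrow> nat pair_pre_digraph \<Rightarrow> nat pair_pre_digraph pmf" where
  "attachment_step f n H =
     map_pmf (\<lambda>e. add_vertex n {m \<in> {1..n}. e m} H)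
       (Pi_pmf {1..n} False (\<lambda>m. bernoulli_pmf (f (in_degree (with_proj H) m) / real n)))"

text \<open>
  Any realisation of the network on any probability space is admitted. Time starts at 1;
  \<open>G 0\<close> is unconstrained. Conditioning on the graph at time \<open>n\<close> is
  conditioning on the whole past, since that graph almost surely determines the earlier ones
  (the graph at time \<open>k\<close> is the one induced on the vertices \<open>1, ..., k\<close>).
\<close>

locale attachment_network = prob_space M
  for M :: "'a measure" +
  fixes f :: "nat \<Rightarrow> real" and G :: "nat \<Rightarrow> 'a \<Rightarrow> nat pair_pre_digraph"
  assumes graph_measurable: "\<And>n. n \<ge> 1 \<Longrightarrow> G n \<in> measurable M (count_space UNIV)"
    and graph_initial: "AE \<omega> in M. G 1 \<omega> = initial_graph"
    and graph_step: "\<And>n H H'. n \<ge> 1 \<Longrightarrow> prob {\<omega> \<in> space M. G n \<omega> = H} > 0 \<Longrightarrow>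
      cond_prob M (\<lambda>\<omega>. G (Suc n) \<omega> = H') (\<lambda>\<omega>. G n \<omega> = H) = pmf (attachment_step f n H) H'"

definition has_max_indegree :: "nat pair_pre_digraph \<Rightarrow> nat \<Rightarrow> bool" where
  "has_max_indegree H m \<longleftrightarrow>
     m \<in> pverts H \<and> in_degree (with_proj H) m = Max (in_degree (with_proj H) ` pverts H)"

definition persistent_hub :: "(nat \<Rightarrow> nat pair_pre_digraph) \<Rightarrow> nat \<Rightarrow> bool" where
  "persistent_hub g m \<longleftrightarrow> (\<forall>\<^sub>F n in sequentially. has_max_indegree (g n) m)"

text \<open>
  A hub selection is a deterministic choice of a vertex of maximal indegree, with an
  arbitrary way of breaking ties, which may depend on the whole current graph.
  Vertices are labelled by their times of birth, so the selected vertex is the index of the hub.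
\<close>

definition hub_selection :: "(nat pair_pre_digraph \<Rightarrow> nat) \<Rightarrow> bool" where
  "hub_selection hub \<longleftrightarrow>
     (\<forall>H. finite (pverts H) \<and> pverts H \<noteq> {} \<longrightarrow> has_max_indegree H (hub H))"

definition tends_to_infinity_in_prob :: "'a measure \<Rightarrow> (nat \<Rightarrow> 'a \<Rightarrow> nat) \<Rightarrow> bool" where
  "tends_to_infinity_in_prob M X \<longleftrightarrow>
     (\<forall>K. (\<lambda>n. measure M {\<omega> \<in> space M. X n \<omega> > K}) \<longlonglongrightarrow> 1)"

end

theory Submission
  imports Defs
begin

text \<open>
  Write \<open>Z m n\<close> for the indegree of vertex \<open>m\<close> at time \<open>n\<close>. Each arc from the new vertex is drawn
  independently with a probability that depends only on the degree of its head, so the processes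
  \<open>Z 1, Z 2, \<dots>\<close> are independent Markov chains: \<open>Z m\<close> starts at \<open>0\<close> at time \<open>m\<close> and goes from \<open>k\<close>
  to \<open>k + 1\<close> at time \<open>n\<close> with probability \<open>f k / n\<close> (lemma \<open>expectation_prod_degrees\<close>). On the scale
  \<open>\<Phi> k = (\<Sum>l<k. 1 / f l)\<close> the drift of every chain at time \<open>n\<close> is exactly \<open>1 / n\<close>, and the fluctuations
  collected while a chain climbs through all levels have total variance of order \<open>\<Sum>k. 1 / (f k)\<^sup>2\<close>.
  If this is finite the order of the degrees freezes; if it is infinite the birth times are
  forgotten.

  One identity is behind both halves. Let \<open>q j n k\<close> be the probability that \<open>Z j n = k\<close>, with
  distribution function \<open>F j n k\<close>. Both \<open>D n k = f k * q j n k\<close> and \<open>D n k = F j n k - F m n k\<close> solve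
  \<open>D (n + 1) k = (1 - f k / n) * D n k + f k / n * D n (k - 1)\<close>,
  which replaces each value by an average of two old ones.

  Weak preference. For a nonnegative, finitely supported solution \<open>D\<close> the sum of \<open>D n k / f k\<close> over
  \<open>k\<close> is conserved, while the sum of \<open>(D n k)\<^sup>2 / f k\<close> loses at least \<open>1 / (2 * n)\<close> times the sum of the
  squared increments of \<open>D n\<close>. If the maximum of \<open>D n\<close> stayed above some \<open>s > 0\<close>, conservation would
  force \<open>D n\<close> to drop to \<open>s / 2\<close> within a bounded distance on the scale \<open>\<Phi>\<close>, say at level \<open>k\<close>, hence
  within \<open>O(f k)\<close> levels; and \<open>\<Phi> k = O(ln n)\<close>. The Cauchy-Schwarz inequality turns this into a loss
  of at least \<open>c / (n * f k)\<close> at time \<open>n\<close>, and the sum of these losses over \<open>n\<close> diverges together with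
  \<open>\<Sum>k. 1 / (f k)\<^sup>2\<close>. So \<open>D n\<close> tends to \<open>0\<close> uniformly (theorem \<open>transport.sup_tendsto_0\<close>). Consequently
  the degrees of a fixed vertex \<open>m\<close> and of \<open>J\<close> younger vertices are asymptotically independent with
  the same law, and the atoms of this law vanish; the chance that \<open>m\<close> has the largest degree is
  asymptotically at most \<open>1 / (J + 1)\<close>, for every \<open>J\<close>. Concavity and the divergence of the series make
  \<open>f k / n\<close> at most \<open>1 / 2\<close> for \<open>k \<le> n\<close> and large \<open>n\<close>, so that averaging really mixes neighbouring levels.

  Strong preference. For \<open>\<theta> > 0\<close> and two vertices \<open>i\<close> and \<open>j\<close>, multiply \<open>\<Prod>l. 1 + \<theta> / f l\<close> over the levels
  below \<open>Z i n\<close> with \<open>\<Prod>l. 1 - \<theta> / f l\<close> over the levels below \<open>Z j n\<close>, both from a high level \<open>k0\<close>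
  onwards. Once \<open>Z j n \<ge> k0\<close> this is a supermartingale. It is at least \<open>1 / 2\<close> when the degrees are equal,
  and at most \<open>exp (- \<theta> * (\<Phi> (Z j n) - \<Phi> (Z i n)))\<close> when \<open>k0 \<le> Z i n \<le> Z j n\<close>; so it bounds the
  probability that the two degrees meet later (theorem \<open>meeting.prob_meet_le\<close>). For \<open>j \<ge> 2\<close> the averaging
  recursion gives \<open>f k * q j n k \<le> 1\<close>, so the degree of \<open>j\<close> is spread out on the scale \<open>\<Phi>\<close>, and on
  average the bound for either order of the two degrees is at most \<open>2 / \<theta>\<close>. Letting first the time
  and then \<open>\<theta>\<close> tend to infinity, any two degrees agree only finitely often. Take \<open>\<theta> = 2\<close>: on the event
  that vertex \<open>1\<close> has degree at least \<open>k0\<close> at a given time, a later vertex \<open>j\<close> ever reaches vertex \<open>1\<close>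
  with probability of order \<open>1 / j\<^sup>2\<close>, so only finitely many vertices do. Finitely many candidates whose order is eventually constant leave a persistent hub.
\<close>

section \<open>The averaging recursion\<close>

definition log_scale :: "(nat \<Rightarrow> real) \<Rightarrow> nat \<Rightarrow> real" where
  "log_scale f k = (\<Sum>l<k. 1 / f l)"

text \<open>
  On the scale \<open>log_scale f\<close> level \<open>l\<close> occupies a segment of length \<open>1 / f l\<close>, so the integral of
  \<open>1 / f\<close> over this scale is \<open>\<Sum>l. 1 / (f l)\<^sup>2\<close>. Sampling the integrand along an arithmetic progression
  \<open>a + c * i\<close> keeps the divergence because \<open>f\<close> is monotone; \<open>m i\<close> is the highest level below the
  \<open>i\<close>-th sampling point.
\<close>

lemma scaled_log_scale_divergence:
  fixes f :: "nat \<Rightarrow> real"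
  assumes f_pos: "\<And>k. f k > 0" and f_mono: "mono f"
    and div: "\<not> summable (\<lambda>k. 1 / (f k)\<^sup>2)" and a: "a \<ge> 0" and c: "c > 0"
  obtains m where "\<And>i k. log_scale f k \<le> a + c * real i \<Longrightarrow> f k \<le> f (m i)"
    and "\<not> summable (\<lambda>i. 1 / f (m i))"
proof -
  let ?L = "log_scale f"
  have L_Suc: "?L (Suc k) = ?L k + 1 / f k" for k by (simp add: log_scale_def)
  have f_nn: "0 \<le> f k" for k using f_pos[of k] by simp
  have L_mono: "mono ?L"
    by (intro monoI) (auto simp: log_scale_def f_nn intro!: sum_mono2)
  have f0: "f 0 \<le> f k" for k using f_mono by (simp add: mono_def)
  have sq_le: "1 / (f k)\<^sup>2 \<le> (1 / f j) * (1 / f k)" if "j \<le> k" for j k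
  proof -
    have "f j \<le> f k" using f_mono that by (simp add: mono_def)
    then have "1 / f k \<le> 1 / f j" using f_pos by (simp add: frac_le)
    then have "1 / f k * (1 / f k) \<le> 1 / f j * (1 / f k)"
      using f_pos[of k] by (intro mult_right_mono) auto
    then show ?thesis by (simp add: power2_eq_square)
  qed
  have unbounded: "\<exists>k. u < ?L k" for u
  proof (rule ccontr)
    assume "\<not> (\<exists>k. u < ?L k)"
    then have u: "?L k \<le> u" for k by (simp add: not_less)
    have "(\<Sum>l<k. 1 / (f l)\<^sup>2) \<le> 1 / f 0 * u" for k
    proof -
      have "(\<Sum>l<k. 1 / (f l)\<^sup>2) \<le> (\<Sum>l<k. (1 / f 0) * (1 / f l))"
        by (intro sum_mono sq_le) auto
      also have "\<dots> = 1 / f 0 * ?L k" by (simp add: log_scale_def sum_distrib_left)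
      also have "\<dots> \<le> 1 / f 0 * u" using u f_pos[of 0] by (intro mult_left_mono) auto
      finally show ?thesis .
    qed
    then have "summable (\<lambda>k. 1 / (f k)\<^sup>2)" by (intro summableI_nonneg_bounded) auto
    then show False using div by simp
  qed
  have "\<exists>m. ?L m \<le> a + c * real i \<and> a + c * real i < ?L (Suc m)" for i
  proof -
    obtain k where k: "a + c * real i < ?L k" using unbounded by blast
    have "\<not> a + c * real i < ?L 0" using a c by (simp add: log_scale_def not_less)
    from ex_least_nat_less[of "\<lambda>k. a + c * real i < ?L k", OF k this] show ?thesis
      by (auto simp: not_less)
  qed
  then obtain m where m: "\<And>i. ?L (m i) \<le> a + c * real i"
    "\<And>i. a + c * real i < ?L (Suc (m i))" by metis
  have le_m: "k \<le> m i" if "?L k \<le> a + c * real i" for k i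
  proof (rule ccontr)
    assume "\<not> k \<le> m i"
    then have "?L (Suc (m i)) \<le> ?L k" using L_mono by (simp add: mono_def)
    then show False using m(2)[of i] that by simp
  qed
  have m_mono: "m i \<le> m (Suc i)" for i
    using m(1)[of i] c by (intro le_m) (simp add: algebra_simps)
  have S_eq: "(\<Sum>l<k'. g l) = (\<Sum>l<k. g l) + (\<Sum>l=k..<k'. g l)" if "k \<le> k'" for k k' and g :: "nat \<Rightarrow> real"
    using that by (metis atLeast0LessThan sum.atLeastLessThan_concat zero_le)
  let ?S = "\<lambda>k. \<Sum>l<k. 1 / (f l)\<^sup>2"
  have step: "?S (m (Suc i)) \<le> ?S (m i) + (c + 1 / f 0) * (1 / f (m i))" for i
  proof -
    have "(\<Sum>l=m i..<m (Suc i). 1 / (f l)\<^sup>2) \<le> (\<Sum>l=m i..<m (Suc i). (1 / f (m i)) * (1 / f l))"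
      by (intro sum_mono sq_le) auto
    also have "\<dots> = 1 / f (m i) * (?L (m (Suc i)) - ?L (m i))"
      using S_eq[OF m_mono[of i], of "\<lambda>l. 1 / f l"] by (simp add: log_scale_def sum_distrib_left)
    also have "\<dots> \<le> 1 / f (m i) * (c + 1 / f 0)"
    proof (intro mult_left_mono)
      have "1 / f (m i) \<le> 1 / f 0" using f0 f_pos by (simp add: frac_le)
      then show "?L (m (Suc i)) - ?L (m i) \<le> c + 1 / f 0"
        using m(1)[of "Suc i"] m(2)[of i] by (simp add: L_Suc algebra_simps)
    qed (use f_pos[of "m i"] in auto)
    finally show ?thesis using S_eq[OF m_mono[of i], of "\<lambda>l. 1 / (f l)\<^sup>2"] by (simp add: mult.commute)
  qed
  have tele: "?S (m n) \<le> ?S (m 0) + (c + 1 / f 0) * (\<Sum>i<n. 1 / f (m i))" for n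
  proof (induction n)
    case (Suc n)
    then show ?case using step[of n] by (simp add: algebra_simps)
  qed simp
  have "\<not> summable (\<lambda>i. 1 / f (m i))"
  proof
    assume sm: "summable (\<lambda>i. 1 / f (m i))"
    let ?B = "?S (m 0) + (c + 1 / f 0) * (\<Sum>i. 1 / f (m i))"
    have "?S k \<le> ?B" for k
    proof -
      obtain n where "?L k / c < real n" using reals_Archimedean2 by blast
      then have "?L k \<le> a + c * real n" using a c by (simp add: field_simps)
      then have "k \<le> m n" by (rule le_m)
      then have "?S k \<le> ?S (m n)" by (intro sum_mono2) auto
      also note tele[of n]
      also have "?S (m 0) + (c + 1 / f 0) * (\<Sum>i<n. 1 / f (m i)) \<le> ?B"
        using f_nn c by (intro add_left_mono mult_left_mono sum_le_suminf sm) auto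
      finally show ?thesis .
    qed
    then have "summable (\<lambda>k. 1 / (f k)\<^sup>2)" by (intro summableI_nonneg_bounded) auto
    then show False using div by simp
  qed
  moreover have "f k \<le> f (m i)" if "?L k \<le> a + c * real i" for i k
    using le_m[OF that] f_mono by (simp add: mono_def)
  ultimately show ?thesis using that by blast
qed

text \<open>
  The recursion moves values upwards: \<open>case_nat 0 (D n) k\<close> is the value at the level below \<open>k\<close>,
  and \<open>0\<close> at the bottom. A solution \<open>D\<close> divided by \<open>f\<close> follows the forward equation of the degree
  chain, so \<open>D\<close> is a density with respect to \<open>log_scale f\<close>.
\<close>

locale transport =
  fixes f :: "nat \<Rightarrow> real" and n0 :: nat and D :: "nat \<Rightarrow> nat \<Rightarrow> real"
  assumes f_pos: "\<And>k. f k > 0" and f_mono: "mono f" and n0_pos: "n0 \<ge> 1"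
    and f_half: "\<And>n k. n0 \<le> n \<Longrightarrow> k \<le> n \<Longrightarrow> f k \<le> real n / 2"
    and rec: "\<And>n k. n0 \<le> n \<Longrightarrow>
      D (Suc n) k = (1 - f k / n) * D n k + f k / n * case_nat 0 (D n) k"
    and D0_nonneg: "\<And>k. D n0 k \<ge> 0" and D0_supp: "\<And>k. n0 \<le> k \<Longrightarrow> D n0 k = 0"
begin

lemma f_nn: "0 \<le> f k"
  using f_pos[of k] by simp

lemma supp: "n0 \<le> n \<Longrightarrow> n \<le> k \<Longrightarrow> D n k = 0"
proof (induction n arbitrary: k rule: dec_induct)
  case base then show ?case by (rule D0_supp)
next
  case (step n)
  then show ?case by (cases k) (auto simp: rec)
qed

lemma p_bounds: "n0 \<le> n \<Longrightarrow> k \<le> n \<Longrightarrow> 0 \<le> f k / n \<and> f k / n \<le> 1 / 2"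
  using f_half[of n k] f_pos[of k] n0_pos by (auto simp: field_simps)

lemma p_01: "n0 \<le> n \<Longrightarrow> k \<le> n \<Longrightarrow> 0 \<le> f k / n \<and> f k / n \<le> 1"
  using p_bounds[of n k] by linarith

lemma nonneg: "n0 \<le> n \<Longrightarrow> 0 \<le> D n k"
proof (induction n arbitrary: k rule: dec_induct)
  case base then show ?case by (rule D0_nonneg)
next
  case (step n)
  show ?case
  proof (cases "k \<le> n")
    case True
    have "0 \<le> case_nat 0 (D n) k" using step.IH by (cases k) auto
    then have "0 \<le> (1 - f k / n) * D n k + f k / n * case_nat 0 (D n) k"
      using p_01[OF step.hyps(1) True] step.IH[of k]
      by (intro add_nonneg_nonneg mult_nonneg_nonneg) auto
    then show ?thesis by (simp only: rec[OF step.hyps(1)])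
  next
    case False
    then show ?thesis using supp[of "Suc n" k] step.hyps by simp
  qed
qed

text \<open>
  The new values are averages of old ones.
\<close>

lemma sup_le_mono:
  assumes "n0 \<le> n" "n \<le> n'" "\<And>k. D n k \<le> s"
  shows "D n' k \<le> s"
  using assms(2)
proof (induction n' arbitrary: k rule: dec_induct)
  case base then show ?case using assms by simp
next
  case (step n')
  have n': "n0 \<le> n'" using step assms by simp
  have s: "0 \<le> s" using nonneg[OF n', of 0] step.IH[of 0] by simp
  show ?case
  proof (cases "k \<le> n'")
    case True
    have "case_nat 0 (D n') k \<le> s" using step.IH s by (cases k) auto
    then have "(1 - f k / n') * D n' k + f k / n' * case_nat 0 (D n') k
        \<le> (1 - f k / n') * s + f k / n' * s"
      using p_01[OF n' True] step.IH[of k] by (intro add_mono mult_left_mono) auto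
    also have "\<dots> = s" by (simp add: algebra_simps)
    finally show ?thesis by (simp add: rec n')
  next
    case False
    then show ?thesis using supp[of "Suc n'" k] n' s by simp
  qed
qed

definition mass :: real where "mass = (\<Sum>k<n0. D n0 k / f k)"

lemma sum_shift: "n0 \<le> n \<Longrightarrow> (\<Sum>k<Suc n. case_nat 0 (D n) k) = (\<Sum>k<n. D n k)"
  by (subst sum.lessThan_Suc_shift) simp

lemma mass_conserved: "n0 \<le> n \<Longrightarrow> (\<Sum>k<n. D n k / f k) = mass"
proof (induction n rule: dec_induct)
  case base show ?case by (simp add: mass_def)
next
  case (step n)
  have "D (Suc n) k / f k = D n k / f k - D n k / n + case_nat 0 (D n) k / n" for k
    using f_pos[of k] step.hyps by (simp add: rec field_simps)
  then have "(\<Sum>k<Suc n. D (Suc n) k / f k)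
      = (\<Sum>k<Suc n. D n k / f k) - (\<Sum>k<Suc n. D n k) / n + (\<Sum>k<Suc n. case_nat 0 (D n) k) / n"
    by (simp only: sum.distrib sum_subtractf sum_divide_distrib)
  also have "\<dots> = (\<Sum>k<n. D n k / f k)"
    using sum_shift[of n] step.hyps supp[of n n] by simp
  finally show ?case using step.IH by simp
qed

definition energy :: "nat \<Rightarrow> real" where "energy n = (\<Sum>k<n. (D n k)\<^sup>2 / f k)"
definition dissipation :: "nat \<Rightarrow> real" where
  "dissipation n = (\<Sum>k<Suc n. (D n k - case_nat 0 (D n) k)\<^sup>2)"

lemma dissipation_nonneg: "0 \<le> dissipation n"
  unfolding dissipation_def by (intro sum_nonneg) auto

text \<open>
  The convexity defect of the square,
  \<open>(1 - p) * a\<^sup>2 + p * b\<^sup>2 - ((1 - p) * a + p * b)\<^sup>2 = p * (1 - p) * (a - b)\<^sup>2\<close> with \<open>p = f k / n\<close>,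
  divided by \<open>f k\<close>, is what the energy loses at level \<open>k\<close>; the rest only moves up by one level, since \<open>p / f k = 1 / n\<close>.
\<close>

lemma energy_step:
  assumes n: "n0 \<le> n"
  shows "energy (Suc n) \<le> energy n - dissipation n / (2 * n)"
proof -
  have npos: "real n > 0" using n n0_pos by simp
  let ?c = "\<lambda>k. case_nat 0 (D n) k"
  have pt: "(D (Suc n) k)\<^sup>2 / f k
      \<le> (D n k)\<^sup>2 / f k - (D n k)\<^sup>2 / n + (?c k)\<^sup>2 / n - (D n k - ?c k)\<^sup>2 / (2 * n)"
    if k: "k < Suc n" for k
  proof -
    define p where "p = f k / n"
    have p: "0 \<le> p" "p \<le> 1/2" using p_bounds[OF n, of k] k by (auto simp: p_def)
    have pf: "p / f k = 1 / n" using f_pos[of k] by (simp add: p_def)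
    have "(D (Suc n) k)\<^sup>2 = (D n k)\<^sup>2 + p * ((?c k)\<^sup>2 - (D n k)\<^sup>2 - (1 - p) * (D n k - ?c k)\<^sup>2)"
      unfolding rec[OF n] p_def[symmetric] by (simp add: power2_eq_square algebra_simps)
    also have "\<dots> \<le> (D n k)\<^sup>2 + p * ((?c k)\<^sup>2 - (D n k)\<^sup>2 - (1 / 2) * (D n k - ?c k)\<^sup>2)"
      using p by (intro add_left_mono mult_left_mono diff_left_mono mult_right_mono) auto
    finally have "(D (Suc n) k)\<^sup>2 / f k \<le>
        ((D n k)\<^sup>2 + p * ((?c k)\<^sup>2 - (D n k)\<^sup>2 - (1 / 2) * (D n k - ?c k)\<^sup>2)) / f k"
      using f_pos[of k] by (intro divide_right_mono) auto
    also have "\<dots> = (D n k)\<^sup>2 / f k + (p / f k) * ((?c k)\<^sup>2 - (D n k)\<^sup>2 - (1 / 2) * (D n k - ?c k)\<^sup>2)"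
      by (simp add: add_divide_distrib)
    also have "\<dots> = (D n k)\<^sup>2 / f k - (D n k)\<^sup>2 / n + (?c k)\<^sup>2 / n - (D n k - ?c k)\<^sup>2 / (2 * n)"
      unfolding pf using npos by (simp add: field_simps)
    finally show ?thesis .
  qed
  have "energy (Suc n) \<le> (\<Sum>k<Suc n. (D n k)\<^sup>2 / f k - (D n k)\<^sup>2 / n + (?c k)\<^sup>2 / n
      - (D n k - ?c k)\<^sup>2 / (2 * n))"
    unfolding energy_def by (intro sum_mono pt) auto
  also have "\<dots> = (\<Sum>k<Suc n. (D n k)\<^sup>2 / f k) - (\<Sum>k<Suc n. (D n k)\<^sup>2) / n
      + (\<Sum>k<Suc n. (?c k)\<^sup>2) / n - dissipation n / (2 * n)"
    by (simp only: sum.distrib sum_subtractf sum_divide_distrib dissipation_def)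
  also have "(\<Sum>k<Suc n. (?c k)\<^sup>2) = (\<Sum>k<n. (D n k)\<^sup>2)"
    by (subst sum.lessThan_Suc_shift) simp
  also have "(\<Sum>k<Suc n. (D n k)\<^sup>2 / f k) - (\<Sum>k<Suc n. (D n k)\<^sup>2) / n
      + (\<Sum>k<n. (D n k)\<^sup>2) / n - dissipation n / (2 * n) = energy n - dissipation n / (2 * n)"
    using supp[OF n, of n] by (simp add: energy_def)
  finally show ?thesis .
qed

lemma dissipation_sum_le:
  "n0 \<le> n \<Longrightarrow> (\<Sum>i=n0..<n. dissipation i / (2 * i)) \<le> energy n0"
proof -
  assume n: "n0 \<le> n"
  have "(\<Sum>i=n0..<n. dissipation i / (2 * i)) \<le> energy n0 - energy n"
    using n
  proof (induction n rule: dec_induct)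
    case (step n)
    then show ?case using energy_step[of n] by simp
  qed simp
  moreover have "energy n \<ge> 0"
    unfolding energy_def using f_pos by (intro sum_nonneg divide_nonneg_pos) auto
  ultimately show ?thesis by simp
qed

text \<open>
  For \<open>a k = 1 / (\<Prod>l\<le>k. 1 + 1 / f l)\<close> one has \<open>f k * (a (k - 1) - a k) = a k\<close>, so \<open>n * a k\<close> solves
  the recursion except for a larger inflow at the bottom. It therefore dominates \<open>D\<close> up to a constant
  and confines large values of \<open>D n\<close> to levels with \<open>log_scale f k = O(ln n)\<close>.
\<close>

lemma location:
  "\<exists>C::real>0. \<forall>n\<ge>n0. \<forall>k. D n k * (\<Prod>l\<le>k. 1 + 1 / f l) \<le> C * n"
proof -
  define P where "P k = (\<Prod>l\<le>k. 1 + 1 / f l)" for k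
  have P_pos: "P k > 0" for k
    unfolding P_def using f_pos by (intro prod_pos) (auto intro: add_pos_pos)
  define C where "C = 1 + (\<Sum>k<n0. D n0 k * P k)"
  have s0: "(\<Sum>k<n0. D n0 k * P k) \<ge> 0"
    using D0_nonneg P_pos by (intro sum_nonneg mult_nonneg_nonneg) (auto intro: less_imp_le)
  have C: "C > 0" using s0 by (simp add: C_def)
  have "D n k * P k \<le> C * n" if "n0 \<le> n" for n k
    using that
  proof (induction n arbitrary: k rule: dec_induct)
    case base
    have "D n0 k * P k \<le> C"
    proof (cases "k < n0")
      case True
      then have "D n0 k * P k \<le> (\<Sum>k<n0. D n0 k * P k)"
        using D0_nonneg P_pos
        by (intro member_le_sum mult_nonneg_nonneg) (auto intro: less_imp_le)
      then show ?thesis by (simp add: C_def)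
    next
      case False then show ?thesis using D0_supp[of k] C by simp
    qed
    also have "C \<le> C * n0" using C n0_pos by simp
    finally show ?case .
  next
    case (step n)
    have npos: "real n > 0" using step n0_pos by simp
    show ?case
    proof (cases "k \<le> n")
      case True
      have c: "case_nat 0 (D n) k * P k \<le> (1 + 1 / f k) * (C * n)"
      proof (cases k)
        case 0
        then show ?thesis using C f_pos[of 0] npos by (simp add: add_pos_pos)
      next
        case (Suc i)
        have "D n i * P i * (1 + 1 / f k) \<le> C * n * (1 + 1 / f k)"
          using step.IH[of i] f_pos[of k] by (intro mult_right_mono) auto
        then show ?thesis by (simp add: Suc P_def mult_ac)
      qed
      have "D (Suc n) k * P k = (1 - f k / n) * (D n k * P k) + f k / n * (case_nat 0 (D n) k * P k)"
        by (simp add: rec step.hyps algebra_simps)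
      also have "\<dots> \<le> (1 - f k / n) * (C * n) + f k / n * ((1 + 1 / f k) * (C * n))"
        using p_01[OF step.hyps(1) True] step.IH c
        by (intro add_mono mult_left_mono) auto
      also have "\<dots> = C * Suc n" using npos f_pos[of k] by (simp add: field_simps)
      finally show ?thesis .
    next
      case False
      then show ?thesis using supp[of "Suc n" k] step.hyps C by simp
    qed
  qed
  then have "\<forall>n\<ge>n0. \<forall>k. D n k * (\<Prod>l\<le>k. 1 + 1 / f l) \<le> C * n"
    by (auto simp: P_def)
  then show ?thesis using C by (intro exI[of _ C] conjI)
qed

text \<open>
  Above a level \<open>j\<close> where \<open>D n\<close> is at least \<open>s\<close>, let \<open>k\<close> be the first level with \<open>D n k < s / 2\<close>. The
  mass between them bounds their distance on the scale \<open>log_scale f\<close> by \<open>2 * mass / s\<close>, hence \<open>k - j\<close>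
  by \<open>f k * (2 * mass / s)\<close>; a drop by \<open>s / 2\<close> in so few steps costs dissipation by the
  Cauchy-Schwarz inequality.
\<close>

lemma dissipation_lower:
  assumes n: "n0 \<le> n" and s: "0 < s" "s \<le> D n j"
  shows "\<exists>k. log_scale f k \<le> log_scale f j + 2 * mass / s
           \<and> dissipation n * (8 * mass * f k) \<ge> s ^ 3"
proof -
  have jn: "j < n" using supp[OF n, of j] s by (metis not_le not_less)
  define k where "k = (LEAST k. j < k \<and> D n k < s / 2)"
  have ex: "j < n \<and> D n n < s / 2" using jn supp[OF n, of n] s by simp
  have k: "j < k" "D n k < s / 2" and kn: "k \<le> n"
    using LeastI[of "\<lambda>k. j < k \<and> D n k < s / 2", OF ex]
      Least_le[of "\<lambda>k. j < k \<and> D n k < s / 2", OF ex] by (auto simp: k_def)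
  have big: "D n l \<ge> s / 2" if "j \<le> l" "l < k" for l
    using not_less_Least[of l "\<lambda>k. j < k \<and> D n k < s / 2"] that s
    by (cases "l = j") (auto simp: k_def)
  have diff: "log_scale f k - log_scale f j = (\<Sum>l=j..<k. 1 / f l)"
    using k unfolding log_scale_def
    by (metis atLeast0LessThan less_imp_le sum_diff_nat_ivl zero_le)
  have "(s / 2) * (\<Sum>l=j..<k. 1 / f l) \<le> (\<Sum>l=j..<k. D n l / f l)"
    unfolding sum_distrib_left
  proof (intro sum_mono)
    fix l assume "l \<in> {j..<k}"
    then show "s / 2 * (1 / f l) \<le> D n l / f l"
      using divide_right_mono[of "s / 2" "D n l" "f l"] big[of l] less_imp_le[OF f_pos[of l]]
      by simp
  qed
  also have "\<dots> \<le> (\<Sum>l<n. D n l / f l)"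
    using kn nonneg[OF n] f_pos by (intro sum_mono2) (auto intro: divide_nonneg_pos)
  also have "\<dots> = mass" by (rule mass_conserved[OF n])
  finally have w: "(\<Sum>l=j..<k. 1 / f l) \<le> 2 * mass / s"
    using s by (simp add: field_simps)
  have len: "real (k - j) \<le> f k * (2 * mass / s)"
  proof -
    have "real (k - j) = (\<Sum>l=j..<k. 1)" by simp
    also have "\<dots> \<le> (\<Sum>l=j..<k. f k * (1 / f l))"
      using f_pos f_mono by (intro sum_mono) (auto simp: field_simps mono_def)
    also have "\<dots> = f k * (\<Sum>l=j..<k. 1 / f l)" by (simp add: sum_distrib_left)
    also have "\<dots> \<le> f k * (2 * mass / s)"
      using w f_pos[of k] by (intro mult_left_mono) auto
    finally show ?thesis .
  qed
  let ?g = "\<lambda>l. D n (Suc l) - D n l"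
  have diss_ge: "(\<Sum>l=j..<k. (?g l)\<^sup>2) \<le> dissipation n"
  proof -
    have "(\<Sum>l=j..<k. (?g l)\<^sup>2) \<le> (\<Sum>l<n. (?g l)\<^sup>2)"
      using kn by (intro sum_mono2) auto
    also have "\<dots> \<le> dissipation n"
      unfolding dissipation_def by (subst sum.lessThan_Suc_shift) simp
    finally show ?thesis .
  qed
  have "D n k - D n j = (\<Sum>l=j..<k. ?g l)"
    using k by (simp add: sum_Suc_diff')
  then have "(D n k - D n j)\<^sup>2 = (\<Sum>l=j..<k. 1 * ?g l)\<^sup>2" by simp
  also have "\<dots> \<le> (\<Sum>l=j..<k. 1\<^sup>2) * (\<Sum>l=j..<k. (?g l)\<^sup>2)"
    by (rule Cauchy_Schwarz_ineq_sum)
  also have "\<dots> \<le> real (k - j) * dissipation n"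
    using diss_ge by (auto intro: mult_left_mono)
  also have "\<dots> \<le> f k * (2 * mass / s) * dissipation n"
    using len diss_ge sum_nonneg[of "{j..<k}" "\<lambda>l. (?g l)\<^sup>2"] by (intro mult_right_mono) auto
  finally have 1: "(D n k - D n j)\<^sup>2 \<le> f k * (2 * mass / s) * dissipation n" .
  have "(s / 2)\<^sup>2 \<le> (D n j - D n k)\<^sup>2"
    using k s by (intro power_mono) auto
  then have "(s / 2)\<^sup>2 \<le> f k * (2 * mass / s) * dissipation n"
    using 1 by (simp add: power2_commute)
  then have "s\<^sup>2 / 4 \<le> f k * (2 * mass) * dissipation n / s" by (simp add: power_divide)
  then have "s\<^sup>2 / 4 * s \<le> f k * (2 * mass) * dissipation n"
    using s by (simp add: pos_le_divide_eq)
  then have "s ^ 3 \<le> dissipation n * (8 * mass * f k)"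
    by (simp add: power2_eq_square power3_eq_cube algebra_simps)
  moreover have "log_scale f k \<le> log_scale f j + 2 * mass / s"
    using diff w by simp
  ultimately show ?thesis by blast
qed

lemma log_scale_location:
  assumes s: "0 < s"
  shows "\<exists>a\<ge>0. \<forall>n\<ge>n0. \<forall>k. s \<le> D n k \<longrightarrow> log_scale f k \<le> a + (1 + 1 / f 0) * ln n"
proof -
  obtain C :: real where C: "C > 0" "\<And>n k. n0 \<le> n \<Longrightarrow> D n k * (\<Prod>l\<le>k. 1 + 1 / f l) \<le> C * n"
    using location by blast
  define r where "r = 1 + 1 / f 0"
  have r: "r > 0" using f_pos[of 0] by (simp add: r_def add_pos_pos)
  have bound: "log_scale f k \<le> r * \<bar>ln (C / s)\<bar> + r * ln n" if n: "n0 \<le> n" and k: "s \<le> D n k" for n k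
  proof -
    let ?P = "\<Prod>l\<le>k. 1 + 1 / f l"
    have pos: "0 < 1 + 1 / f l" for l using f_pos[of l] by (simp add: add_pos_pos)
    have P: "?P > 0" using pos by (intro prod_pos) auto
    have npos: "real n > 0" using n n0_pos by simp
    have "s * ?P \<le> D n k * ?P" using k P by (intro mult_right_mono) auto
    also have "\<dots> \<le> C * n" by (rule C(2)[OF n])
    finally have "?P \<le> C / s * n" using s by (simp add: field_simps)
    then have "ln ?P \<le> ln (C / s * n)" using P by (simp add: ln_mono)
    also have "\<dots> = ln (C / s) + ln n" using C(1) s npos by (subst ln_mult) auto
    finally have 1: "ln ?P \<le> ln (C / s) + ln n" .
    have "log_scale f k \<le> (\<Sum>l\<le>k. 1 / f l)"
      unfolding log_scale_def by (intro sum_mono2) (auto simp: f_nn)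
    also have "\<dots> \<le> (\<Sum>l\<le>k. r * ln (1 + 1 / f l))"
    proof (intro sum_mono)
      fix l
      define x where "x = 1 / f l"
      have x: "x > 0" using f_pos[of l] by (simp add: x_def)
      have "x \<le> 1 / f 0" using f_pos f_mono by (simp add: x_def frac_le mono_def)
      then have xr: "1 + x \<le> r" by (simp add: r_def)
      have "x / r \<le> x / (1 + x)" using x xr by (intro divide_left_mono) auto
      also have "\<dots> = 1 - inverse (1 + x)" using x by (simp add: field_simps)
      also have "\<dots> \<le> ln (1 + x)"
        using ln_le_minus_one[of "inverse (1 + x)"] x by (simp add: ln_inverse)
      finally have "x \<le> ln (1 + x) * r" using r by (simp add: pos_divide_le_eq)
      then show "1 / f l \<le> r * ln (1 + 1 / f l)" by (simp add: x_def mult.commute)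
    qed
    also have "\<dots> = r * ln ?P" using less_imp_neq[OF pos] by (subst ln_prod) (auto simp: sum_distrib_left)
    also have "\<dots> \<le> r * (ln (C / s) + ln n)" using 1 r by (intro mult_left_mono) auto
    also have "\<dots> \<le> r * (\<bar>ln (C / s)\<bar> + ln n)" using r by (intro mult_left_mono) auto
    finally show ?thesis by (simp add: algebra_simps)
  qed
  have "0 \<le> r * \<bar>ln (C / s)\<bar>" using r by simp
  then show ?thesis using bound unfolding r_def by blast
qed

text \<open>
  If the maximum stayed above \<open>s\<close>, every dyadic block \<open>2 ^ i \<le> n < 2 ^ (i + 1)\<close> would dissipate
  at least a multiple of \<open>1 / f (m i)\<close>, where \<open>m i\<close> is the highest level that \<open>location\<close> and
  \<open>dissipation_lower\<close> permit in this block. These terms have a divergent sum, but the energy is finite.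
\<close>

theorem sup_tendsto_0:
  assumes div: "\<not> summable (\<lambda>k. 1 / (f k)\<^sup>2)" and e: "0 < e"
  shows "\<exists>N. \<forall>n\<ge>N. \<forall>k. D n k < e"
proof (rule ccontr)
  assume contr: "\<not> ?thesis"
  define s where "s = e / 2"
  have s: "s > 0" "s < e" using e by (auto simp: s_def)
  have large: "\<exists>k. s \<le> D n k" if n: "n0 \<le> n" for n
  proof (rule ccontr)
    assume "\<not> (\<exists>k. s \<le> D n k)"
    then have "D n' k \<le> s" if "n \<le> n'" for n' k
      using sup_le_mono[OF n that] by (meson less_imp_le not_le)
    then show False using contr s by (meson le_less_trans)
  qed
  obtain a where a: "a \<ge> 0"
    "\<And>n k. n0 \<le> n \<Longrightarrow> s \<le> D n k \<Longrightarrow> log_scale f k \<le> a + (1 + 1 / f 0) * ln n"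
    using log_scale_location[OF s(1)] by blast
  have mass0: "mass \<ge> 0"
    unfolding mass_def using D0_nonneg f_pos by (intro sum_nonneg divide_nonneg_pos) auto
  have mass: "mass > 0"
  proof (rule ccontr)
    assume "\<not> mass > 0"
    then have "mass = 0" using mass0 by simp
    moreover obtain j where "s \<le> D n0 j" using large[of n0] by auto
    ultimately show False
      using dissipation_lower[of n0 s j] s by auto
  qed
  define r where "r = 1 + 1 / f 0"
  have r: "r > 0" using f_pos[of 0] by (simp add: r_def add_pos_pos)
  \<comment> \<open>the offset covers the end of a dyadic block and the drop in \<open>dissipation_lower\<close>\<close>
  define b where "b = a + r + 2 * mass / s"
  have b: "b \<ge> 0" using a(1) r mass s by (simp add: b_def)
  obtain m where m: "\<And>i k. log_scale f k \<le> b + r * real i \<Longrightarrow> f k \<le> f (m i)"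
    and m_div: "\<not> summable (\<lambda>i. 1 / f (m i))"
    using scaled_log_scale_divergence[OF f_pos f_mono div b r] by blast
  have diss: "dissipation n \<ge> s ^ 3 / (8 * mass * f (m i))"
    if n: "n0 \<le> n" "n \<le> 2 ^ Suc i" for n i
  proof -
    obtain j where j: "s \<le> D n j" using large[OF n(1)] by blast
    obtain k where k: "log_scale f k \<le> log_scale f j + 2 * mass / s"
      "dissipation n * (8 * mass * f k) \<ge> s ^ 3"
      using dissipation_lower[OF n(1) s(1) j] by blast
    have "ln (real n) \<le> ln (2 ^ Suc i)"
      using n n0_pos of_nat_mono[OF n(2), where 'a = real] by (simp add: ln_mono)
    also have "\<dots> = Suc i * ln 2" by (rule ln_realpow)
    also have "\<dots> \<le> real (Suc i) * 1" using ln_2_less_1 by (intro mult_left_mono) auto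
    finally have "r * ln (real n) \<le> r * Suc i" using r by simp
    then have "log_scale f j \<le> a + r * Suc i"
      using a(2)[OF n(1) j] unfolding r_def by linarith
    then have "f k \<le> f (m i)" using k(1) by (intro m) (simp add: b_def algebra_simps)
    then have "dissipation n * (8 * mass * f k) \<le> dissipation n * (8 * mass * f (m i))"
      using mass by (intro mult_left_mono) (auto simp: dissipation_nonneg)
    then show ?thesis using k(2) mass f_pos[of "m i"] by (simp add: field_simps)
  qed
  define q where "q = s ^ 3 / (32 * mass)"
  have q: "q > 0" using s mass by (simp add: q_def)
  have block: "q / f (m i) \<le> (\<Sum>n=2^i..<2^Suc i. dissipation n / (2 * n))" if i: "n0 \<le> i" for i
  proof -
    have n0i: "n0 \<le> 2 ^ i" using i less_exp[of i] by linarith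
    have "q / f (m i) = (\<Sum>n=(2::nat)^i..<2^Suc i. q / f (m i) / 2 ^ i)" by simp
    also have "\<dots> \<le> (\<Sum>n=2^i..<2^Suc i. dissipation n / (2 * n))"
    proof (intro sum_mono)
      fix n :: nat assume n: "n \<in> {2^i..<2^Suc i}"
      then have n': "n0 \<le> n" "n \<le> 2 ^ Suc i" using n0i by auto
      have npos: "real n > 0" using n' n0_pos by simp
      have "real n \<le> real (2 ^ Suc i)" using n' by (simp only: of_nat_le_iff)
      then have n2: "2 * real n \<le> 4 * 2 ^ i" by simp
      have "q / f (m i) / 2 ^ i = s ^ 3 / (8 * mass * f (m i)) / (4 * 2 ^ i)"
        by (simp add: q_def)
      also have "\<dots> \<le> dissipation n / (4 * 2 ^ i)"
        using diss[OF n'] by (intro divide_right_mono) auto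
      also have "\<dots> \<le> dissipation n / (2 * n)"
        using n2 npos by (intro divide_left_mono) (auto simp: dissipation_nonneg)
      finally show "q / f (m i) / 2 ^ i \<le> dissipation n / (2 * n)" .
    qed
    finally show ?thesis .
  qed
  have "(\<Sum>i<N. 1 / f (m (i + n0))) \<le> energy n0 / q" for N
  proof -
    have n0: "n0 \<le> 2 ^ n0" using less_exp[of n0] by linarith
    have "(\<Sum>i<N. q / f (m (i + n0))) \<le> (\<Sum>n=2^n0..<2^(N+n0). dissipation n / (2 * n))"
    proof (induction N)
      case (Suc N)
      have "(\<Sum>n=2^n0..<2^(Suc N+n0). dissipation n / (2 * n))
        = (\<Sum>n=2^n0..<2^(N+n0). dissipation n / (2 * n))
          + (\<Sum>n=2^(N+n0)..<2^Suc (N+n0). dissipation n / (2 * n))"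
        by (subst sum.atLeastLessThan_concat) (auto intro: power_increasing)
      then show ?case using Suc block[of "N + n0"] by simp
    qed simp
    also have "\<dots> \<le> (\<Sum>n=n0..<2^(N+n0). dissipation n / (2 * n))"
      using n0 by (intro sum_mono2) (auto simp: dissipation_nonneg)
    also have "\<dots> \<le> energy n0"
      using n0 by (intro dissipation_sum_le order.trans[OF n0 power_increasing]) auto
    finally have "(\<Sum>i<N. q * (1 / f (m (i + n0)))) \<le> energy n0" by simp
    then show ?thesis using q
      by (subst (asm) sum_distrib_left[symmetric]) (simp add: pos_le_divide_eq mult.commute)
  qed
  then have "summable (\<lambda>i. 1 / f (m (i + n0)))"
    by (intro summableI_nonneg_bounded) (auto simp: f_nn)
  then have "summable (\<lambda>i. 1 / f (m i))" by (rule summable_iff_shift[THEN iffD1])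
  then show False using m_div by simp
qed

end

section \<open>The law of the network and the independence of degrees\<close>

abbreviation indeg :: "nat pair_pre_digraph \<Rightarrow> nat \<Rightarrow> nat" where
  "indeg H m \<equiv> in_degree (with_proj H) m"

text \<open>
  The indegree at an earlier time \<open>t\<close>, read off from a later graph: tails are labelled by their times of
  birth. Events about the whole past thus become events about the current graph.
\<close>

definition indeg_until :: "nat \<Rightarrow> nat pair_pre_digraph \<Rightarrow> nat \<Rightarrow> nat" where
  "indeg_until t H m = card {u. (u, m) \<in> parcs H \<and> u \<le> t}"

definition network_graph :: "nat \<Rightarrow> nat pair_pre_digraph \<Rightarrow> bool" where
  "network_graph n H \<longleftrightarrow> pverts H = {1..n} \<and> (\<forall>(u, v) \<in> parcs H. 1 \<le> v \<and> v < u \<and> u \<le> n)"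

lemma indeg_eq_card: "indeg H m = card {u. (u, m) \<in> parcs H}"
proof -
  have "in_arcs (with_proj H) m = (\<lambda>u. (u, m)) ` {u. (u, m) \<in> parcs H}"
    by (auto simp: in_arcs_def)
  then show ?thesis
    by (simp add: in_degree_def card_image inj_on_def)
qed

lemma network_graph_heads: "network_graph n H \<Longrightarrow> {u. (u, m) \<in> parcs H} \<subseteq> {m<..n}"
  by (auto simp: network_graph_def)

lemma indeg_le: "network_graph n H \<Longrightarrow> indeg H m \<le> n - m"
  unfolding indeg_eq_card
  using card_mono[OF _ network_graph_heads[of n H m]] by simp

lemma indeg_eq_until: "network_graph n H \<Longrightarrow> indeg_until n H m = indeg H m"
  unfolding indeg_eq_card indeg_until_def
  by (rule arg_cong[where f = card]) (auto simp: network_graph_def)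

lemma network_graph_add_vertex:
  "network_graph n H \<Longrightarrow> S \<subseteq> {1..n} \<Longrightarrow> network_graph (Suc n) (add_vertex n S H)"
  by (fastforce simp: network_graph_def add_vertex_def)

lemma indeg_add_vertex:
  assumes H: "network_graph n H"
  shows "indeg (add_vertex n S H) m = indeg H m + of_bool (m \<in> S)"
proof -
  have fin: "finite {u. (u, m) \<in> parcs H}"
    using network_graph_heads[OF H, of m] by (rule finite_subset) simp
  have "{u. (u, m) \<in> parcs (add_vertex n S H)}
      = (if m \<in> S then insert (Suc n) {u. (u, m) \<in> parcs H} else {u. (u, m) \<in> parcs H})"
    by (auto simp: add_vertex_def)
  moreover have "Suc n \<notin> {u. (u, m) \<in> parcs H}"
    using network_graph_heads[OF H, of m] by auto
  ultimately show ?thesis using fin by (simp add: indeg_eq_card)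
qed

lemma indeg_until_add_vertex:
  "t \<le> n \<Longrightarrow> indeg_until t (add_vertex n S H) m = indeg_until t H m"
  unfolding indeg_until_def
  by (rule arg_cong[where f = card]) (auto simp: add_vertex_def)

text \<open>
  Time starts at \<open>0\<close> with the empty graph, from which the general step leads to the graph at time \<open>1\<close>.
\<close>

primrec graph_law :: "(nat \<Rightarrow> real) \<Rightarrow> nat \<Rightarrow> nat pair_pre_digraph pmf" where
  "graph_law f 0 = return_pmf \<lparr> pverts = {}, parcs = {} \<rparr>"
| "graph_law f (Suc n) = bind_pmf (graph_law f n) (attachment_step f n)"

text \<open>
  \<open>degree_law f j n k\<close> is the probability that vertex \<open>j\<close> has indegree \<open>k\<close> at time \<open>n\<close>; before its
  birth at time \<open>j\<close> the indegree counts as \<open>0\<close>. This is a plain recursion on reals: at the levels that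
  carry mass, \<open>f k / n\<close> is a probability.
\<close>

primrec degree_law :: "(nat \<Rightarrow> real) \<Rightarrow> nat \<Rightarrow> nat \<Rightarrow> nat \<Rightarrow> real" where
  "degree_law f j 0 k = of_bool (k = 0)"
| "degree_law f j (Suc n) k =
    (if n < j then of_bool (k = 0)
     else (1 - f k / n) * degree_law f j n k
       + case_nat 0 (\<lambda>i. f i / n * degree_law f j n i) k)"

lemma graph_law_1: "graph_law f 1 = return_pmf initial_graph"
  by (simp add: attachment_step_def add_vertex_def initial_graph_def bind_return_pmf)

lemma set_attachment_step:
  "H' \<in> set_pmf (attachment_step f n H) \<Longrightarrow> \<exists>S\<subseteq>{1..n}. H' = add_vertex n S H"
proof -
  assume "H' \<in> set_pmf (attachment_step f n H)"
  then obtain e where "H' = add_vertex n {m \<in> {1..n}. e m} H"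
    unfolding attachment_step_def set_map_pmf by blast
  then show ?thesis by (intro exI[of _ "{m \<in> {1..n}. e m}"]) auto
qed

lemma finite_set_attachment_step [simp]: "finite (set_pmf (attachment_step f n H))"
  by (rule finite_subset[of _ "(\<lambda>S. add_vertex n S H) ` Pow {1..n}"])
     (auto dest!: set_attachment_step)

lemma finite_set_graph_law [simp]: "finite (set_pmf (graph_law f n))"
  by (induction n) auto

lemma network_graph_law: "H \<in> set_pmf (graph_law f n) \<Longrightarrow> network_graph n H"
proof (induction n arbitrary: H)
  case 0 then show ?case by (auto simp: network_graph_def)
next
  case (Suc n)
  then obtain H0 where "H0 \<in> set_pmf (graph_law f n)" "H \<in> set_pmf (attachment_step f n H0)"
    by auto
  then show ?case using Suc.IH[of H0] set_attachment_step network_graph_add_vertex by blast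
qed

lemma integrable_graph_law [simp]:
  "integrable (measure_pmf (graph_law f n)) (h :: _ \<Rightarrow> real)"
  by (rule integrable_measure_pmf_finite) simp

lemma integrable_attachment_step [simp]:
  "integrable (measure_pmf (attachment_step f n H)) (h :: _ \<Rightarrow> real)"
  by (rule integrable_measure_pmf_finite) simp

lemma expectation_graph_law_Suc:
  fixes h :: "_ \<Rightarrow> real"
  shows "measure_pmf.expectation (graph_law f (Suc n)) h
    = measure_pmf.expectation (graph_law f n) (\<lambda>H. measure_pmf.expectation (attachment_step f n H) h)"
proof -
  have "measure_pmf.expectation (graph_law f (Suc n)) h
      = (\<Sum>H\<in>set_pmf (graph_law f n). pmf (graph_law f n) H *\<^sub>R
          measure_pmf.expectation (attachment_step f n H) h)"
    unfolding graph_law.simps by (rule pmf_expectation_bind) auto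
  also have "\<dots> = measure_pmf.expectation (graph_law f n)
      (\<lambda>H. measure_pmf.expectation (attachment_step f n H) h)"
    by (rule integral_measure_pmf[symmetric]) auto
  finally show ?thesis .
qed

lemma expectation_graph_law_mono:
  fixes h h' :: "_ \<Rightarrow> real"
  assumes "\<And>H. H \<in> set_pmf (graph_law f n) \<Longrightarrow> h H \<le> h' H"
  shows "measure_pmf.expectation (graph_law f n) h \<le> measure_pmf.expectation (graph_law f n) h'"
  by (rule integral_mono_AE) (auto intro: AE_pmfI assms)

lemma expectation_graph_law_cong:
  fixes h h' :: "_ \<Rightarrow> real"
  assumes "\<And>H. H \<in> set_pmf (graph_law f n) \<Longrightarrow> h H = h' H"
  shows "measure_pmf.expectation (graph_law f n) h = measure_pmf.expectation (graph_law f n) h'"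
  by (rule integral_cong_AE) (auto intro: AE_pmfI assms)

locale attachment =
  fixes f :: "nat \<Rightarrow> real"
  assumes rule: "attachment_rule f"
begin

lemma f_mono: "mono f" and f_pos: "0 < f k" and f_le: "f k \<le> real k + 1"
  using rule by (auto simp: attachment_rule_def)

lemma f_nn: "0 \<le> f k"
  using f_pos[of k] by simp

lemma prob_le_1: "k < n \<Longrightarrow> f k / n \<le> 1"
  using f_le[of k] by (simp add: divide_le_eq)

lemma expectation_attachment_step:
  assumes H: "network_graph n H" and A: "A \<subseteq> {1..n}" and \<phi>: "\<And>j k. 0 \<le> \<phi> j k"
  shows "measure_pmf.expectation (attachment_step f n H) (\<lambda>H'. \<Prod>j\<in>A. \<phi> j (indeg H' j))
    = (\<Prod>j\<in>A. (1 - f (indeg H j) / n) * \<phi> j (indeg H j) + f (indeg H j) / n * \<phi> j (Suc (indeg H j)))"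
proof -
  let ?x = "indeg H"
  let ?p = "\<lambda>j. bernoulli_pmf (f (?x j) / real n)"
  let ?g = "\<lambda>j e. if j \<in> A then \<phi> j (?x j + of_bool e) else (1::real)"
  have restrict: "(\<Prod>j\<in>A. h j) = (\<Prod>j\<in>{1..n}. if j \<in> A then h j else 1)" for h :: "nat \<Rightarrow> real"
    using A by (simp add: prod.If_cases Int_absorb1)
  have "measure_pmf.expectation (attachment_step f n H) (\<lambda>H'. \<Prod>j\<in>A. \<phi> j (indeg H' j))
      = measure_pmf.expectation (Pi_pmf {1..n} False ?p) (\<lambda>e. \<Prod>j\<in>{1..n}. ?g j (e j))"
    unfolding attachment_step_def integral_map_pmf restrict
    by (intro Bochner_Integration.integral_cong refl prod.cong) (auto simp: indeg_add_vertex[OF H])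
  also have "\<dots> = (\<Prod>j\<in>{1..n}. measure_pmf.expectation (?p j) (?g j))"
    by (rule expectation_prod_Pi_pmf) (auto simp: \<phi> intro!: integrable_measure_pmf_finite)
  also have "\<dots> = (\<Prod>j\<in>{1..n}. if j \<in> A then (1 - f (?x j) / n) * \<phi> j (?x j)
      + f (?x j) / n * \<phi> j (Suc (?x j)) else 1)"
  proof (intro prod.cong refl)
    fix j assume j: "j \<in> {1..n}"
    have "?x j < n" using indeg_le[OF H, of j] j by auto
    then have "f (?x j) / n \<le> 1" by (rule prob_le_1)
    then show "measure_pmf.expectation (?p j) (?g j) = (if j \<in> A then (1 - f (?x j) / n) * \<phi> j (?x j)
        + f (?x j) / n * \<phi> j (Suc (?x j)) else 1)"
      using f_nn[of "?x j"] by (subst integral_bernoulli_pmf) (auto simp: mult.commute)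
  qed
  also have "\<dots> = (\<Prod>j\<in>A. (1 - f (?x j) / n) * \<phi> j (?x j) + f (?x j) / n * \<phi> j (Suc (?x j)))"
    by (rule restrict[symmetric])
  finally show ?thesis .
qed

lemma degree_law_early: "n \<le> j \<Longrightarrow> degree_law f j n k = of_bool (k = 0)"
  by (cases n) auto

lemma degree_law_supp: "n < k + j \<Longrightarrow> k > 0 \<Longrightarrow> degree_law f j n k = 0"
proof (induction n arbitrary: k)
  case (Suc n)
  show ?case
  proof (cases "n < j")
    case True then show ?thesis using Suc.prems by simp
  next
    case False
    have "degree_law f j n i = 0" if "k = Suc i" for i
      using Suc.IH[of i] Suc.prems False that by auto
    then show ?thesis using Suc by (auto split: nat.split)
  qed
qed simp

lemma degree_law_nonneg: "1 \<le> j \<Longrightarrow> 0 \<le> degree_law f j n k"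
proof (induction n arbitrary: k)
  case (Suc n)
  show ?case
  proof (cases "n < j")
    case False
    have "0 \<le> (1 - f k / n) * degree_law f j n k"
    proof (cases "k < n")
      case True
      then show ?thesis using prob_le_1[OF True] Suc by (intro mult_nonneg_nonneg) auto
    next
      case k: False
      then have "k > 0" using False Suc.prems by simp
      then show ?thesis using degree_law_supp[of n k j] Suc.prems k by simp
    qed
    moreover have "0 \<le> case_nat 0 (\<lambda>i. f i / n * degree_law f j n i) k"
      using Suc f_nn by (auto split: nat.split intro!: divide_nonneg_nonneg mult_nonneg_nonneg)
    ultimately show ?thesis using False by simp
  qed simp
qed simp

lemma sum_degree_law_Suc:
  assumes "1 \<le> j" "j \<le> n"
  shows "(\<Sum>k<Suc n. degree_law f j (Suc n) k * \<phi> k)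
    = (\<Sum>k<n. degree_law f j n k * ((1 - f k / n) * \<phi> k + f k / n * \<phi> (Suc k)))"
proof -
  let ?q = "degree_law f j n"
  have "(\<Sum>k<Suc n. degree_law f j (Suc n) k * \<phi> k)
      = (\<Sum>k<Suc n. (1 - f k / n) * ?q k * \<phi> k)
        + (\<Sum>k<Suc n. case_nat 0 (\<lambda>i. f i / n * ?q i) k * \<phi> k)"
    unfolding sum.distrib[symmetric] distrib_right[symmetric]
    using assms by (intro sum.cong refl) simp
  also have "(\<Sum>k<Suc n. (1 - f k / n) * ?q k * \<phi> k) = (\<Sum>k<n. (1 - f k / n) * ?q k * \<phi> k)"
    using degree_law_supp[of n n j] assms by simp
  also have "(\<Sum>k<Suc n. case_nat 0 (\<lambda>i. f i / n * ?q i) k * \<phi> k) = (\<Sum>k<n. f k / n * ?q k * \<phi> (Suc k))"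
    by (subst sum.lessThan_Suc_shift) simp
  finally show ?thesis by (simp add: sum.distrib[symmetric] algebra_simps)
qed

text \<open>
  Independence of the degrees of distinct vertices: each step is a product measure whose factors
  depend on one degree each, so it maps products of functions of single degrees to such products.
  In the proof the one-step average is truncated at \<open>0\<close> to stay nonnegative at levels that are never
  reached.
\<close>

theorem expectation_prod_degrees:
  assumes A: "A \<subseteq> {1..n}" and \<phi>: "\<And>j k. 0 \<le> \<phi> j k"
  shows "measure_pmf.expectation (graph_law f n) (\<lambda>H. \<Prod>j\<in>A. \<phi> j (indeg H j))
    = (\<Prod>j\<in>A. \<Sum>k<n. degree_law f j n k * \<phi> j k)"
  using A \<phi>
proof (induction n arbitrary: A \<phi>)
  case 0 then show ?case by simp
next
  case (Suc n)
  let ?B = "A \<inter> {1..n}"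
  let ?\<psi> = "\<lambda>j k. (1 - f k / n) * \<phi> j k + f k / n * \<phi> j (Suc k)"
  let ?\<psi>' = "\<lambda>j k. max 0 (?\<psi> j k)"
  define c where "c = (if Suc n \<in> A then \<phi> (Suc n) 0 else 1)"
  have split: "(\<Prod>j\<in>A. h j) = (if Suc n \<in> A then h (Suc n) else 1) * (\<Prod>j\<in>?B. h j)"
    for h :: "nat \<Rightarrow> real"
  proof -
    have fin: "finite A" using Suc.prems(1) finite_subset by blast
    have "A - {Suc n} = ?B" using Suc.prems(1) by (auto simp: le_Suc_eq)
    then show ?thesis
      using prod.remove[OF fin, of "Suc n" h] by (cases "Suc n \<in> A") auto
  qed
  have inner: "measure_pmf.expectation (attachment_step f n H) (\<lambda>H'. \<Prod>j\<in>A. \<phi> j (indeg H' j))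
      = c * (\<Prod>j\<in>?B. ?\<psi>' j (indeg H j))"
    if "H \<in> set_pmf (graph_law f n)" for H
  proof -
    have H: "network_graph n H" using that by (rule network_graph_law)
    have new: "indeg H' (Suc n) = 0" if "H' \<in> set_pmf (attachment_step f n H)" for H'
      using set_attachment_step[OF that] network_graph_add_vertex[OF H] indeg_le[of "Suc n" H' "Suc n"]
      by auto
    have "measure_pmf.expectation (attachment_step f n H) (\<lambda>H'. \<Prod>j\<in>A. \<phi> j (indeg H' j))
       = measure_pmf.expectation (attachment_step f n H) (\<lambda>H'. c * (\<Prod>j\<in>?B. \<phi> j (indeg H' j)))"
      by (rule integral_cong_AE) (auto intro!: AE_pmfI simp: split new c_def)
    also have "\<dots> = c * (\<Prod>j\<in>?B. ?\<psi> j (indeg H j))"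
      by (subst integral_mult_right_zero, subst expectation_attachment_step[OF H _ Suc.prems(2)]) auto
    also have "\<dots> = c * (\<Prod>j\<in>?B. ?\<psi>' j (indeg H j))"
    proof (intro arg_cong2[where f = "(*)"] prod.cong refl)
      fix j assume j: "j \<in> ?B"
      then have "indeg H j < n" using indeg_le[OF H, of j] by auto
      from prob_le_1[OF this] have "0 \<le> ?\<psi> j (indeg H j)"
        using f_nn[of "indeg H j"] Suc.prems(2)
        by (intro add_nonneg_nonneg mult_nonneg_nonneg) auto
      then show "?\<psi> j (indeg H j) = ?\<psi>' j (indeg H j)" by simp
    qed
    finally show ?thesis .
  qed
  have "measure_pmf.expectation (graph_law f (Suc n)) (\<lambda>H. \<Prod>j\<in>A. \<phi> j (indeg H j))
      = measure_pmf.expectation (graph_law f n) (\<lambda>H. c * (\<Prod>j\<in>?B. ?\<psi>' j (indeg H j)))"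
    unfolding expectation_graph_law_Suc by (rule expectation_graph_law_cong) (rule inner)
  also have "\<dots> = c * (\<Prod>j\<in>?B. \<Sum>k<n. degree_law f j n k * ?\<psi>' j k)"
    by (subst integral_mult_right_zero, subst Suc.IH) auto
  also have "(\<Prod>j\<in>?B. \<Sum>k<n. degree_law f j n k * ?\<psi>' j k)
      = (\<Prod>j\<in>?B. \<Sum>k<Suc n. degree_law f j (Suc n) k * \<phi> j k)"
  proof (intro prod.cong refl)
    fix j assume j: "j \<in> ?B"
    have "?\<psi>' j k = ?\<psi> j k" if "k < n" for k
    proof -
      have "0 \<le> ?\<psi> j k"
        using f_nn[of k] Suc.prems(2) prob_le_1[OF that]
        by (intro add_nonneg_nonneg mult_nonneg_nonneg) auto
      then show ?thesis by simp
    qed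
    then show "(\<Sum>k<n. degree_law f j n k * ?\<psi>' j k) = (\<Sum>k<Suc n. degree_law f j (Suc n) k * \<phi> j k)"
      using j by (subst sum_degree_law_Suc) auto
  qed
  also have "c * \<dots> = (\<Prod>j\<in>A. \<Sum>k<Suc n. degree_law f j (Suc n) k * \<phi> j k)"
  proof -
    have "(\<Sum>k<Suc n. degree_law f (Suc n) (Suc n) k * \<phi> (Suc n) k) = \<phi> (Suc n) 0"
      by (subst sum.lessThan_Suc_shift) (simp add: degree_law_early)
    then show ?thesis unfolding c_def split by simp
  qed
  finally show ?case .
qed

lemma degree_law_sum: "1 \<le> j \<Longrightarrow> j \<le> n \<Longrightarrow> (\<Sum>k<n. degree_law f j n k) = 1"
  using expectation_prod_degrees[of "{j}" n "\<lambda>_ _. 1"] by simp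

text \<open>
  The averaging recursion for \<open>f k * degree_law f j n k\<close> preserves upper bounds as long as its weights
  lie between \<open>0\<close> and \<open>1\<close>. Vertex \<open>1\<close> is excluded: for \<open>f k = k + 1\<close> its degree at time \<open>n\<close> is \<open>n - 1\<close> with
  certainty, and \<open>f (n - 1) = n\<close>. For \<open>j \<ge> 2\<close> the degree is at most \<open>n - 2\<close>.
\<close>

lemma f_degree_law_le: "2 \<le> j \<Longrightarrow> f k * degree_law f j n k \<le> 1"
proof (induction n arbitrary: k)
  case 0 then show ?case using f_le[of 0] by simp
next
  case (Suc n)
  show ?case
  proof (cases "n < j")
    case True
    then show ?thesis using f_le[of 0] by simp
  next
    case False
    show ?thesis
    proof (cases "k < n")
      case k: True
      have p: "0 \<le> f k / n" using f_nn by simp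
      have prev: "case_nat 0 (\<lambda>i. f i * degree_law f j n i) k \<le> 1"
        using Suc by (auto split: nat.split)
      have "f k * degree_law f j (Suc n) k = (1 - f k / n) * (f k * degree_law f j n k)
          + f k / n * case_nat 0 (\<lambda>i. f i * degree_law f j n i) k"
        using False by (simp add: algebra_simps split: nat.split)
      also have "\<dots> \<le> (1 - f k / n) * 1 + f k / n * 1"
        using prob_le_1[OF k] p prev Suc by (intro add_mono mult_left_mono) auto
      also have "\<dots> = 1" by simp
      finally show ?thesis .
    next
      case k: False
      then show ?thesis using degree_law_supp[of "Suc n" k j] Suc.prems False by simp
    qed
  qed
qed

end

section \<open>Weak preference: every fixed vertex loses the lead\<close>

lemma power_diff_le:
  fixes x y :: real
  assumes "0 \<le> x" "x \<le> y" "y \<le> 1"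
  shows "y ^ J - x ^ J \<le> J * (y - x)"
proof (induction J)
  case (Suc J)
  have x1: "x ^ J \<le> 1" using assms by (intro power_le_one) auto
  have "y ^ Suc J - x ^ Suc J = y * (y ^ J - x ^ J) + x ^ J * (y - x)" by (simp add: algebra_simps)
  also have "\<dots> \<le> 1 * (y ^ J - x ^ J) + 1 * (y - x)"
    using assms x1 power_mono[of x y J] by (intro add_mono mult_right_mono) auto
  also have "\<dots> \<le> Suc J * (y - x)" using Suc by (simp add: algebra_simps)
  finally show ?case .
qed simp

lemma power_diff_ge:
  fixes x y :: real
  assumes "0 \<le> x" "x \<le> y"
  shows "Suc J * ((y - x) * x ^ J) \<le> y ^ Suc J - x ^ Suc J"
proof (induction J)
  case (Suc J)
  have "Suc (Suc J) * ((y - x) * x ^ Suc J) = x * (Suc J * ((y - x) * x ^ J)) + x ^ Suc J * (y - x)"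
    by (simp add: algebra_simps)
  also have "\<dots> \<le> y * (y ^ Suc J - x ^ Suc J) + x ^ Suc J * (y - x)"
    using Suc assms by (intro add_mono mult_mono) auto
  also have "\<dots> = y ^ Suc (Suc J) - x ^ Suc (Suc J)" by (simp add: algebra_simps)
  finally show ?case .
qed simp

text \<open>
  The sum is the probability that one of \<open>J + 1\<close> independent variables with law \<open>q\<close> is a maximum, ties
  included. Without atoms it would be the integral of \<open>x ^ J\<close> over the unit interval; atoms of size at
  most \<open>e\<close> change this Riemann sum by at most \<open>J * e\<close>.
\<close>

lemma sum_cdf_power_le:
  fixes q :: "nat \<Rightarrow> real"
  assumes q: "\<And>k. 0 \<le> q k" "\<And>k. q k \<le> e" and total: "(\<Sum>k<n. q k) \<le> 1"
  shows "(\<Sum>k<n. q k * (\<Sum>l\<le>k. q l) ^ J) \<le> 1 / Suc J + J * e"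
proof -
  have e: "0 \<le> e" using q[of 0] by simp
  have "(\<Sum>k<n. q k * (\<Sum>l\<le>k. q l) ^ J) \<le> (\<Sum>k<n. q k) ^ Suc J / Suc J + J * e * (\<Sum>k<n. q k)"
    using total
  proof (induction n)
    case (Suc n)
    define x where "x = (\<Sum>k<n. q k)"
    define y where "y = x + q n"
    have x: "0 \<le> x" "x \<le> y" "y \<le> 1" "y - x = q n"
      using q Suc.prems by (auto simp: x_def y_def intro: sum_nonneg)
    have "q n * y ^ J \<le> q n * (x ^ J + J * q n)"
      using power_diff_le[OF x(1-3), of J] q x by (intro mult_left_mono) auto
    also have "\<dots> = q n * x ^ J + J * q n * q n" by (simp add: algebra_simps)
    also have "\<dots> \<le> (y ^ Suc J - x ^ Suc J) / Suc J + J * e * q n"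
    proof (intro add_mono mult_right_mono mult_left_mono)
      show "q n * x ^ J \<le> (y ^ Suc J - x ^ Suc J) / Suc J"
        using power_diff_ge[OF x(1,2), of J] by (simp add: x(4) pos_le_divide_eq mult.commute del: of_nat_Suc power_Suc)
    qed (use q in auto)
    finally have "q n * y ^ J \<le> (y ^ Suc J - x ^ Suc J) / Suc J + J * e * q n" .
    moreover have "(\<Sum>k<n. q k * (\<Sum>l\<le>k. q l) ^ J) \<le> x ^ Suc J / Suc J + J * e * x"
      unfolding x_def using Suc.prems q(1)[of n] by (intro Suc.IH) auto
    moreover have "(\<Sum>l\<le>n. q l) = y" "(\<Sum>k<Suc n. q k) = y"
      by (auto simp: y_def x_def lessThan_Suc_atMost[symmetric])
    ultimately show ?case
      by (simp add: y_def[symmetric] x_def[symmetric] diff_divide_distrib algebra_simps del: of_nat_Suc power_Suc)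
        (simp add: y_def algebra_simps)
  qed simp
  also have "\<dots> \<le> 1 / Suc J + J * e * 1"
    using total q e by (intro add_mono divide_right_mono power_le_one mult_left_mono)
      (auto intro: sum_nonneg)
  finally show ?thesis by simp
qed

text \<open>
  The increments of \<open>f\<close> decrease. If all of them were above \<open>1 / 4\<close>, then \<open>f\<close> would grow linearly and
  \<open>1 / (f k)\<^sup>2\<close> would be summable. So the slope is eventually at most \<open>1 / 4\<close>.
\<close>

lemma concave_weak_sublinear:
  assumes rule: "attachment_rule f" and conc: "concave_rule f"
    and div: "\<not> summable (\<lambda>k. 1 / (f k)\<^sup>2)"
  shows "\<exists>n0\<ge>1. \<forall>n\<ge>n0. \<forall>k\<le>n. f k \<le> real n / 2"
proof -
  have f_pos: "0 < f k" for k using rule by (simp add: attachment_rule_def)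
  obtain K where K: "f (Suc K) - f K \<le> 1 / 4"
  proof (rule ccontr)
    assume "\<not> thesis"
    then have "1 / 4 < f (Suc k) - f k" for k using that by (meson not_le)
    then have inc: "f k + 1 / 4 \<le> f (Suc k)" for k by (smt (verit))
    define c where "c = min (f 0) (1 / 4)"
    have c: "c > 0" using f_pos by (simp add: c_def)
    have lin: "c * Suc k \<le> f k" for k
    proof (induction k)
      case (Suc k)
      then show ?case using inc[of k] c by (simp add: c_def min_def algebra_simps split: if_splits)
    qed (simp add: c_def)
    have "summable (\<lambda>k. 1 / real (Suc k) ^ 2)"
      using inverse_power_summable[of 2, where 'a = real]
      by (subst summable_Suc_iff[of "\<lambda>k. 1 / real k ^ 2"]) (simp add: inverse_eq_divide)
    then have "summable (\<lambda>k. (1 / c\<^sup>2) * (1 / real (Suc k) ^ 2))"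
      by (rule summable_mult)
    then have "summable (\<lambda>k. 1 / (f k)\<^sup>2)"
    proof (rule summable_comparison_test')
      fix k :: nat
      have "(c * Suc k)\<^sup>2 \<le> (f k)\<^sup>2" using lin[of k] c by (intro power_mono) auto
      then have "1 / (f k)\<^sup>2 \<le> 1 / (c * Suc k)\<^sup>2" using c by (intro frac_le zero_less_power mult_pos_pos) auto
      then show "norm (1 / (f k)\<^sup>2) \<le> (1 / c\<^sup>2) * (1 / real (Suc k) ^ 2)"
        by (simp add: power_mult_distrib del: of_nat_Suc)
    qed
    then show False using div by simp
  qed
  have inc: "f (Suc k) \<le> f k + 1 / 4" if "K \<le> k" for k
    using conc K that unfolding concave_rule_def antimono_def by (smt (verit, best))
  have le: "f k \<le> f K + k / 4" for k
  proof (cases "K \<le> k")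
    case True
    then show ?thesis
    proof (induction k rule: dec_induct)
      case (step k) then show ?case using inc[of k] by (simp add: add_divide_distrib)
    qed simp
  next
    case False
    then have "f k \<le> f K" using rule by (simp add: attachment_rule_def mono_def)
    then show ?thesis by (simp add: add_increasing2)
  qed
  obtain N :: nat where N: "4 * f K \<le> N" using real_arch_simple by blast
  show ?thesis
  proof (intro exI[of _ "max 1 N"] conjI allI impI)
    fix n k assume n: "max 1 N \<le> n" "k \<le> n"
    then have "4 * f K \<le> n" using N by linarith
    moreover have "real k \<le> real n" using n by simp
    ultimately show "f k \<le> real n / 2" using le[of k] by linarith
  qed simp
qed

context attachment
begin

definition degree_cdf :: "nat \<Rightarrow> nat \<Rightarrow> nat \<Rightarrow> real" where
  "degree_cdf j n k = (\<Sum>l\<le>k. degree_law f j n l)"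

text \<open>
  The distribution function can only change at \<open>k\<close> by a jump from \<open>k\<close> to \<open>k + 1\<close>, and
  \<open>degree_law f j n k\<close> is its increment there.
\<close>

lemma degree_cdf_Suc:
  assumes "j \<le> n"
  shows "degree_cdf j (Suc n) k = (1 - f k / n) * degree_cdf j n k + f k / n * case_nat 0 (degree_cdf j n) k"
proof -
  have "degree_cdf j (Suc n) k = degree_cdf j n k - f k / n * degree_law f j n k"
  proof (induction k)
    case (Suc k)
    then show ?case using assms by (simp add: degree_cdf_def algebra_simps)
  qed (use assms in \<open>simp add: degree_cdf_def algebra_simps\<close>)
  moreover have "degree_law f j n k = degree_cdf j n k - case_nat 0 (degree_cdf j n) k"
    by (cases k) (auto simp: degree_cdf_def)
  ultimately show ?thesis by (simp add: algebra_simps)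
qed

lemma degree_cdf_full:
  assumes "1 \<le> j" "j \<le> n" "n \<le> Suc k"
  shows "degree_cdf j n k = 1"
proof -
  have "degree_cdf j n k = (\<Sum>l<n. degree_law f j n l)"
    unfolding degree_cdf_def
    using assms degree_law_supp[of n _ j] by (intro sum.mono_neutral_right) auto
  then show ?thesis using degree_law_sum assms by simp
qed

lemma degree_cdf_bounds:
  assumes "1 \<le> j" "j \<le> n"
  shows "0 \<le> degree_cdf j n k \<and> degree_cdf j n k \<le> 1"
proof
  show "0 \<le> degree_cdf j n k"
    unfolding degree_cdf_def using assms degree_law_nonneg by (intro sum_nonneg) auto
  have "degree_cdf j n k \<le> degree_cdf j n (max k n)"
    unfolding degree_cdf_def using assms degree_law_nonneg by (intro sum_mono2) auto
  then show "degree_cdf j n k \<le> 1" using degree_cdf_full[of j n "max k n"] assms by simp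
qed

text \<open>
  Older vertices have stochastically larger degrees. This is the sign condition that makes the
  difference of two distribution functions a nonnegative solution of the recursion.
\<close>

lemma degree_cdf_order:
  assumes "1 \<le> m" "m \<le> j" "j \<le> n"
  shows "degree_cdf m n k \<le> degree_cdf j n k"
  using assms(3)
proof (induction n arbitrary: k rule: dec_induct)
  case base
  have "degree_cdf j j k = 1"
    unfolding degree_cdf_def by (subst sum.remove[of _ 0]) (auto simp: degree_law_early)
  then show ?case using degree_cdf_bounds[of m j k] assms by simp
next
  case (step n)
  show ?case
  proof (cases "k < n")
    case True
    have "case_nat 0 (degree_cdf m n) k \<le> case_nat 0 (degree_cdf j n) k"
      using step.IH by (cases k) auto
    then show ?thesis
      using step.IH[of k] prob_le_1[OF True] f_nn[of k] step.hyps assms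
      by (simp only: degree_cdf_Suc) (intro add_mono mult_left_mono; simp)
  next
    case False
    then show ?thesis
      using degree_cdf_full[of m "Suc n" k] degree_cdf_full[of j "Suc n" k] step.hyps assms by simp
  qed
qed

end

locale weak_attachment = attachment +
  assumes concave: "concave_rule f" and divergent: "\<not> summable (\<lambda>k. 1 / (f k)\<^sup>2)"
begin

text \<open>
  The degree has no large atoms: \<open>f k * degree_law f j n k\<close> is a solution of the recursion.
\<close>

lemma eventually_degree_law_small:
  assumes j: "1 \<le> j" and e: "0 < e"
  shows "\<forall>\<^sub>F n in sequentially. \<forall>k. degree_law f j n k \<le> e"
proof -
  obtain n0 where n0: "n0 \<ge> 1" "\<And>n k. n0 \<le> n \<Longrightarrow> k \<le> n \<Longrightarrow> f k \<le> real n / 2"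
    using concave_weak_sublinear[OF rule concave divergent] by blast
  interpret transport f "max n0 j" "\<lambda>n k. f k * degree_law f j n k"
  proof
    fix n k assume "max n0 j \<le> n"
    then show "f k * degree_law f j (Suc n) k = (1 - f k / n) * (f k * degree_law f j n k)
        + f k / n * case_nat 0 (\<lambda>k. f k * degree_law f j n k) k"
      by (simp add: algebra_simps split: nat.split)
  next
    fix k assume "max n0 j \<le> k"
    then show "f k * degree_law f j (max n0 j) k = 0"
      using degree_law_supp[of "max n0 j" k j] j by simp
  qed (use f_pos f_mono f_nn n0 degree_law_nonneg j in auto)
  obtain N where N: "\<And>n k. N \<le> n \<Longrightarrow> f k * degree_law f j n k < f 0 * e"
    using sup_tendsto_0[OF divergent, of "f 0 * e"] f_pos e by (metis mult_pos_pos)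
  have "degree_law f j n k \<le> e" if "N \<le> n" for n k
  proof -
    have "f 0 * degree_law f j n k \<le> f k * degree_law f j n k"
      using f_mono degree_law_nonneg[OF j] by (intro mult_right_mono) (auto simp: mono_def)
    then have "f 0 * degree_law f j n k \<le> f 0 * e" using N[OF that, of k] by linarith
    then show ?thesis using f_pos[of 0] by simp
  qed
  then show ?thesis unfolding eventually_sequentially by blast
qed

text \<open>
  The time of birth is forgotten: a difference of distribution functions is a solution.
\<close>

lemma eventually_degree_cdf_close:
  assumes m: "1 \<le> m" "m \<le> j" and e: "0 < e"
  shows "\<forall>\<^sub>F n in sequentially. \<forall>k. degree_cdf j n k \<le> degree_cdf m n k + e"
proof -
  obtain n0 where n0: "n0 \<ge> 1" "\<And>n k. n0 \<le> n \<Longrightarrow> k \<le> n \<Longrightarrow> f k \<le> real n / 2"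
    using concave_weak_sublinear[OF rule concave divergent] by blast
  interpret transport f "max n0 j" "\<lambda>n k. degree_cdf j n k - degree_cdf m n k"
  proof
    fix n k assume "max n0 j \<le> n"
    then show "degree_cdf j (Suc n) k - degree_cdf m (Suc n) k
       = (1 - f k / n) * (degree_cdf j n k - degree_cdf m n k)
         + f k / n * case_nat 0 (\<lambda>k. degree_cdf j n k - degree_cdf m n k) k"
      using m by (cases k) (auto simp: degree_cdf_Suc algebra_simps diff_divide_distrib)
  next
    fix k assume "max n0 j \<le> k"
    then show "degree_cdf j (max n0 j) k - degree_cdf m (max n0 j) k = 0"
      using degree_cdf_full[of j "max n0 j" k] degree_cdf_full[of m "max n0 j" k] m by simp
  next
    show "0 \<le> degree_cdf j (max n0 j) k - degree_cdf m (max n0 j) k" for k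
      using degree_cdf_order[of m j "max n0 j" k] m by simp
  qed (use f_pos f_mono n0 in auto)
  obtain N where N: "\<And>n k. N \<le> n \<Longrightarrow> degree_cdf j n k - degree_cdf m n k < e"
    using sup_tendsto_0[OF divergent e] by blast
  have "degree_cdf j n k \<le> degree_cdf m n k + e" if "N \<le> n" for n k
    using N[OF that, of k] by simp
  then show ?thesis unfolding eventually_sequentially by blast
qed

end

context attachment
begin

lemma prob_dominates_eq:
  assumes m: "m \<in> {1..n}" and S: "S \<subseteq> {1..n}" "m \<notin> S"
  shows "measure_pmf.prob (graph_law f n) {H. \<forall>j\<in>S. indeg H j \<le> indeg H m}
    = (\<Sum>k<n. degree_law f m n k * (\<Prod>j\<in>S. degree_cdf j n k))"
proof -
  have fin: "finite S" using S(1) finite_subset by blast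
  let ?\<phi> = "\<lambda>k j k'. if j = m then of_bool (k' = k) else of_bool (k' \<le> k) :: real"
  have "measure_pmf.prob (graph_law f n) {H. \<forall>j\<in>S. indeg H j \<le> indeg H m}
      = measure_pmf.expectation (graph_law f n) (indicator {H. \<forall>j\<in>S. indeg H j \<le> indeg H m})"
    by simp
  also have "\<dots> = measure_pmf.expectation (graph_law f n)
      (\<lambda>H. \<Sum>k<n. \<Prod>j\<in>insert m S. ?\<phi> k j (indeg H j))"
  proof (rule expectation_graph_law_cong)
    fix H assume "H \<in> set_pmf (graph_law f n)"
    then have lt: "indeg H m < n" using indeg_le[OF network_graph_law, of H f n m] m by auto
    have "(\<Sum>k<n. \<Prod>j\<in>insert m S. ?\<phi> k j (indeg H j))
        = (\<Sum>k<n. if k = indeg H m then (\<Prod>j\<in>S. of_bool (indeg H j \<le> k)) else 0)"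
      using fin S(2) by (intro sum.cong refl) (auto intro!: prod.cong)
    also have "\<dots> = (\<Prod>j\<in>S. of_bool (indeg H j \<le> indeg H m))"
      using lt by simp
    also have "\<dots> = indicator {H. \<forall>j\<in>S. indeg H j \<le> indeg H m} H"
      using fin by (auto simp: indicator_def)
    finally show "indicator {H. \<forall>j\<in>S. indeg H j \<le> indeg H m} H
      = (\<Sum>k<n. \<Prod>j\<in>insert m S. ?\<phi> k j (indeg H j))" by simp
  qed
  also have "\<dots> = (\<Sum>k<n. \<Prod>j\<in>insert m S. \<Sum>k'<n. degree_law f j n k' * ?\<phi> k j k')"
    by (subst Bochner_Integration.integral_sum)
       (use m S in \<open>auto intro!: sum.cong expectation_prod_degrees\<close>)
  also have "\<dots> = (\<Sum>k<n. degree_law f m n k * (\<Prod>j\<in>S. degree_cdf j n k))"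
  proof (intro sum.cong refl)
    fix k assume k: "k \<in> {..<n}"
    have "(\<Sum>k'<n. degree_law f m n k' * of_bool (k' = k)) = degree_law f m n k"
      using k by (simp add: of_bool_def if_distrib[of "(*) _"] cong: if_cong)
    moreover have "(\<Sum>k'<n. degree_law f j n k' * of_bool (k' \<le> k)) = degree_cdf j n k" for j
      unfolding degree_cdf_def using k by (intro sum.mono_neutral_cong_right) auto
    moreover have "(\<Prod>j\<in>S. \<Sum>k'<n. degree_law f j n k' * ?\<phi> k j k')
        = (\<Prod>j\<in>S. \<Sum>k'<n. degree_law f j n k' * of_bool (k' \<le> k))"
      using S(2) by (intro prod.cong refl sum.cong) auto
    ultimately show "(\<Prod>j\<in>insert m S. \<Sum>k'<n. degree_law f j n k' * ?\<phi> k j k')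
        = degree_law f m n k * (\<Prod>j\<in>S. degree_cdf j n k)"
      using fin S(2) by simp
  qed
  finally show ?thesis .
qed

end

context weak_attachment
begin

text \<open>
  Vertex \<open>m\<close> competes with the \<open>J\<close> next younger vertices, whose degrees have almost the same law as
  its own.
\<close>

theorem prob_max_indegree_tendsto_0:
  assumes m: "1 \<le> m"
  shows "(\<lambda>n. measure_pmf.prob (graph_law f n) {H. has_max_indegree H m}) \<longlonglongrightarrow> 0"
proof (rule tendstoI)
  fix r :: real assume r: "r > 0"
  obtain J :: nat where J: "1 / Suc J < r / 3" "J > 0"
  proof -
    obtain J where "inverse (real (Suc J)) < r / 3" using reals_Archimedean[of "r / 3"] r by auto
    moreover have "1 / real (Suc (Suc J)) \<le> 1 / real (Suc J)" by (intro divide_left_mono) auto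
    ultimately show ?thesis using that[of "Suc J"] by (simp add: inverse_eq_divide)
  qed
  define e where "e = r / (3 * J)"
  have e: "e > 0" using r J by (simp add: e_def)
  define S where "S = {m<..m + J}"
  have "\<forall>\<^sub>F n in sequentially. \<forall>j\<in>S. \<forall>k. degree_cdf j n k \<le> degree_cdf m n k + e"
    using m e eventually_degree_cdf_close by (intro eventually_ball_finite) (auto simp: S_def)
  moreover have "\<forall>\<^sub>F n in sequentially. \<forall>k. degree_law f m n k \<le> e"
    by (rule eventually_degree_law_small[OF m e])
  moreover have "\<forall>\<^sub>F n in sequentially. m + J \<le> n" by (rule eventually_ge_at_top)
  ultimately show "\<forall>\<^sub>F n in sequentially.
    dist (measure_pmf.prob (graph_law f n) {H. has_max_indegree H m}) 0 < r"
  proof eventually_elim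
    case (elim n)
    let ?q = "degree_law f m n" and ?F = "\<lambda>j. degree_cdf j n"
    have Sn: "S \<subseteq> {1..n}" "m \<notin> S" and mn: "m \<in> {1..n}" using elim(3) m by (auto simp: S_def)
    have F01: "0 \<le> ?F j k \<and> ?F j k \<le> 1" if "j \<in> insert m S" for j k
      using degree_cdf_bounds[of j n k] that Sn mn by auto
    have prod_le: "(\<Prod>j\<in>S. ?F j k) \<le> ?F m k ^ J + J * e" for k
    proof -
      have "norm ((\<Prod>j\<in>S. ?F j k) - (\<Prod>j\<in>S. ?F m k)) \<le> (\<Sum>j\<in>S. norm (?F j k - ?F m k))"
        using F01 by (intro norm_prod_diff) auto
      also have "\<dots> \<le> (\<Sum>j\<in>S. e)"
      proof (intro sum_mono)
        fix j assume j: "j \<in> S"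
        then have "?F m k \<le> ?F j k" using m Sn by (intro degree_cdf_order) (auto simp: S_def)
        then show "norm (?F j k - ?F m k) \<le> e" using elim(1) j by (auto simp: algebra_simps)
      qed
      finally show ?thesis by (simp add: S_def abs_le_iff)
    qed
    have "measure_pmf.prob (graph_law f n) {H. has_max_indegree H m}
        \<le> measure_pmf.prob (graph_law f n) {H. \<forall>j\<in>S. indeg H j \<le> indeg H m}"
    proof (rule measure_pmf.finite_measure_mono_AE)
      show "AE H in graph_law f n. H \<in> {H. has_max_indegree H m} \<longrightarrow>
          H \<in> {H. \<forall>j\<in>S. indeg H j \<le> indeg H m}"
      proof (intro AE_pmfI impI CollectI ballI)
        fix H j assume "H \<in> set_pmf (graph_law f n)" "H \<in> {H. has_max_indegree H m}" "j \<in> S"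
        moreover from this have "pverts H = {1..n}"
          using network_graph_law by (auto simp: network_graph_def)
        ultimately show "indeg H j \<le> indeg H m"
          using Sn by (auto simp: has_max_indegree_def intro!: Max_ge)
      qed
    qed simp
    also have "\<dots> = (\<Sum>k<n. ?q k * (\<Prod>j\<in>S. ?F j k))"
      by (rule prob_dominates_eq[OF mn Sn])
    also have "\<dots> \<le> (\<Sum>k<n. ?q k * (?F m k ^ J + J * e))"
      using prod_le degree_law_nonneg[OF m] by (intro sum_mono mult_left_mono) auto
    also have "\<dots> = (\<Sum>k<n. ?q k * ?F m k ^ J) + (\<Sum>k<n. ?q k) * (J * e)"
      by (simp add: distrib_left sum.distrib sum_distrib_right)
    also have "(\<Sum>k<n. ?q k) = 1" using degree_law_sum mn by simp
    also have "(\<Sum>k<n. ?q k * ?F m k ^ J) \<le> 1 / Suc J + J * e"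
      unfolding degree_cdf_def
      using elim(2) degree_law_nonneg[OF m] degree_law_sum[of m n] mn
      by (intro sum_cdf_power_le) auto
    finally have "measure_pmf.prob (graph_law f n) {H. has_max_indegree H m} \<le> 1 / Suc J + J * e + J * e"
      by simp
    also have "\<dots> < r / 3 + r / 3 + r / 3" using J by (simp add: e_def)
    finally show ?case by simp
  qed
qed

end

section \<open>Degrees grow without bound\<close>

context attachment
begin

lemma expectation_degree:
  assumes "j \<in> {1..n}" "\<And>k. 0 \<le> \<phi> k"
  shows "measure_pmf.expectation (graph_law f n) (\<lambda>H. \<phi> (indeg H j))
    = (\<Sum>k<n. degree_law f j n k * \<phi> k)"
  using expectation_prod_degrees[of "{j}" n "\<lambda>_. \<phi>"] assms by simp

text \<open>
  Since \<open>f \<ge> f 0\<close>, the expectation of \<open>(1 / 2) ^ Z\<close> shrinks at time \<open>n\<close> by the factor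
  \<open>1 - f 0 / (2 * n)\<close> or a smaller one, and the product of these factors tends to \<open>0\<close> like a negative power of
  \<open>n\<close>.
\<close>

lemma prob_low_degree_tendsto_0:
  assumes j: "1 \<le> j"
  shows "(\<lambda>n. measure_pmf.prob (graph_law f n) {H. indeg H j < k}) \<longlonglongrightarrow> 0"
proof -
  define c where "c = f 0 / 2"
  have c: "c > 0" using f_pos[of 0] by (simp add: c_def)
  define a where "a n = (\<Sum>k<n. degree_law f j n k * (1 / 2) ^ k)" for n
  have a_nn: "0 \<le> a n" for n
    unfolding a_def using degree_law_nonneg[OF j] by (intro sum_nonneg) auto
  have a_step: "a (Suc n) \<le> (1 - c / n) * a n" if n: "j \<le> n" for n
  proof -
    have "a (Suc n) = (\<Sum>k<n. degree_law f j n k * ((1 - f k / n) * (1 / 2) ^ k + f k / n * (1 / 2) ^ Suc k))"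
      unfolding a_def by (rule sum_degree_law_Suc[OF j n])
    also have "\<dots> \<le> (\<Sum>k<n. (1 - c / n) * (degree_law f j n k * (1 / 2) ^ k))"
    proof (intro sum_mono)
      fix k
      have "f 0 \<le> f k" using f_mono by (simp add: mono_def)
      then have "1 - f k / n / 2 \<le> 1 - c / n"
        using divide_right_mono[of "f 0 / 2" "f k / 2" "real n"]
        by (simp add: c_def mult.commute)
      then have "(1 - f k / n / 2) * (degree_law f j n k * (1 / 2) ^ k)
          \<le> (1 - c / n) * (degree_law f j n k * (1 / 2) ^ k)"
        using degree_law_nonneg[OF j] by (intro mult_right_mono) auto
      then show "degree_law f j n k * ((1 - f k / n) * (1 / 2) ^ k + f k / n * (1 / 2) ^ Suc k)
          \<le> (1 - c / n) * (degree_law f j n k * (1 / 2) ^ k)"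
        by (simp add: algebra_simps)
    qed
    also have "\<dots> = (1 - c / n) * a n" by (simp add: a_def sum_distrib_left)
    finally show ?thesis .
  qed
  have bound: "a n \<le> exp (c * (ln j - ln n))" if "j \<le> n" for n
    using that
  proof (induction n rule: dec_induct)
    case base
    have "a j \<le> (\<Sum>k<j. degree_law f j j k * 1)"
      unfolding a_def using degree_law_nonneg[OF j] by (intro sum_mono mult_left_mono power_le_one) auto
    then show ?case using degree_law_sum[OF j, of j] by simp
  next
    case (step n)
    have npos: "real n > 0" using step j by simp
    have "1 + 1 / n = Suc n / n" using npos by (simp add: field_simps)
    then have "ln (Suc n) - ln n = ln (1 + 1 / n)"
      using npos by (simp add: ln_div del: of_nat_Suc)
    also have "\<dots> \<le> 1 / n" using npos by (intro ln_add_one_self_le_self) auto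
    finally have l: "c * (ln (Suc n) - ln n) \<le> c / n" using c mult_left_mono by fastforce
    have "1 - c / n \<le> exp (- (c / n))" using exp_ge_add_one_self[of "- (c / n)"] by simp
    also have "\<dots> \<le> exp (- (c * (ln (Suc n) - ln n)))" using l by simp
    finally have e: "1 - c / n \<le> exp (- (c * (ln (Suc n) - ln n)))" .
    have "a (Suc n) \<le> (1 - c / n) * a n" using step.hyps by (intro a_step)
    also have "\<dots> \<le> exp (- (c * (ln (Suc n) - ln n))) * a n"
      using e a_nn by (intro mult_right_mono) auto
    also have "\<dots> \<le> exp (- (c * (ln (Suc n) - ln n))) * exp (c * (ln j - ln n))"
      using step.IH by (intro mult_left_mono) auto
    also have "\<dots> = exp (c * (ln j - ln (Suc n)))"
      by (simp add: exp_add[symmetric] algebra_simps)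
    finally show ?case .
  qed
  have upper: "measure_pmf.prob (graph_law f n) {H. indeg H j < k} \<le> 2 ^ k * exp (c * (ln j - ln n))"
    if n: "j \<le> n" for n
  proof -
    have "measure_pmf.prob (graph_law f n) {H. indeg H j < k}
        = measure_pmf.expectation (graph_law f n) (indicator {H. indeg H j < k})" by simp
    also have "\<dots> \<le> measure_pmf.expectation (graph_law f n) (\<lambda>H. 2 ^ k * (1 / 2) ^ indeg H j)"
    proof (rule expectation_graph_law_mono)
      fix H
      show "indicator {H. indeg H j < k} H \<le> 2 ^ k * (1 / 2 :: real) ^ indeg H j"
        by (auto simp: indicator_def power_one_over field_simps intro: power_increasing)
    qed
    also have "\<dots> = 2 ^ k * a n"
      using expectation_degree[of j n "\<lambda>k. (1 / 2) ^ k"] j n by (simp add: a_def)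
    also have "\<dots> \<le> 2 ^ k * exp (c * (ln j - ln n))"
      using bound[OF n] by (intro mult_left_mono) auto
    finally show ?thesis .
  qed
  have "(\<lambda>n. 2 ^ k * exp (c * (ln j - ln (real n)))) \<longlonglongrightarrow> 0"
  proof -
    have "filterlim (\<lambda>n. ln (real n)) at_top sequentially"
      by (rule filterlim_compose[OF ln_at_top filterlim_real_sequentially])
    then have "filterlim (\<lambda>n. - ln j + ln (real n)) at_top sequentially"
      by (intro filterlim_tendsto_add_at_top[OF tendsto_const])
    then have "filterlim (\<lambda>n. c * (- ln j + ln (real n))) at_top sequentially"
      by (rule filterlim_tendsto_pos_mult_at_top[OF tendsto_const c])
    then have "filterlim (\<lambda>n. - (c * (- ln j + ln (real n)))) at_bot sequentially"
      by (simp add: filterlim_uminus_at_top)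
    then have "(\<lambda>n. exp (- (c * (- ln j + ln (real n))))) \<longlonglongrightarrow> 0"
      by (rule filterlim_compose[OF exp_at_bot])
    then have "(\<lambda>n. 2 ^ k * exp (- (c * (- ln j + ln (real n))))) \<longlonglongrightarrow> 2 ^ k * 0"
      by (rule tendsto_mult_left)
    then show ?thesis by (simp add: algebra_simps)
  qed
  moreover have "\<forall>\<^sub>F n in sequentially.
      norm (measure_pmf.prob (graph_law f n) {H. indeg H j < k}) \<le> 2 ^ k * exp (c * (ln j - ln n))"
    using eventually_ge_at_top[of j] by eventually_elim (simp add: upper)
  ultimately show ?thesis by (rule Lim_null_comparison[rotated])
qed

end

section \<open>Meeting of two degrees\<close>

definition degrees_meet :: "nat \<Rightarrow> nat \<Rightarrow> nat \<Rightarrow> nat \<Rightarrow> nat pair_pre_digraph \<Rightarrow> bool" where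
  "degrees_meet i j n N H \<longleftrightarrow> (\<exists>t\<in>{n..N}. indeg_until t H i = indeg_until t H j)"

text \<open>
  The level \<open>k0\<close> lies so high that the factors \<open>1 - \<theta> / f l\<close> are nonnegative from there on and the
  product of all \<open>1 - \<theta>\<^sup>2 / (f l)\<^sup>2\<close> is at least \<open>1 / 2\<close>.
\<close>

locale meeting = attachment +
  fixes \<theta> :: real and k0 :: nat
  assumes \<theta>_pos: "0 < \<theta>" and \<theta>_le: "\<theta> \<le> f k0"
    and tail: "\<And>k. (\<Sum>l=k0..<k. \<theta>\<^sup>2 / (f l)\<^sup>2) \<le> 1 / 2"
begin

text \<open>
  Exponentials \<open>exp (- \<theta> * log_scale f k)\<close> and \<open>exp (\<theta> * log_scale f k)\<close> in product form. With products
  the conditional expectation after a step at time \<open>n\<close> is exactly the old value times \<open>1 - \<theta> / n\<close> or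
  \<open>1 + \<theta> / n\<close>, whatever the current level above \<open>k0\<close>.
\<close>

definition lower :: "nat \<Rightarrow> real" where "lower k = (\<Prod>l=k0..<k. 1 - \<theta> / f l)"
definition upper :: "nat \<Rightarrow> real" where "upper k = (\<Prod>l=k0..<k. 1 + \<theta> / f l)"

lemma factor_bounds:
  assumes "k0 \<le> l"
  shows "0 \<le> 1 - \<theta> / f l \<and> 1 - \<theta> / f l \<le> 1" "\<theta>\<^sup>2 / (f l)\<^sup>2 \<le> 1"
proof -
  have le: "\<theta> \<le> f l" using \<theta>_le f_mono assms by (meson mono_def order.trans)
  then show "0 \<le> 1 - \<theta> / f l \<and> 1 - \<theta> / f l \<le> 1"
    using f_pos[of l] \<theta>_pos by (simp add: divide_le_eq)
  show "\<theta>\<^sup>2 / (f l)\<^sup>2 \<le> 1"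
    using le f_pos[of l] \<theta>_pos by (simp add: divide_le_eq power_mono)
qed

lemma lower_nonneg: "0 \<le> lower k" and lower_le_1: "lower k \<le> 1"
  unfolding lower_def using factor_bounds by (auto intro!: prod_nonneg prod_le_1)

lemma upper_nonneg: "0 \<le> upper k"
  unfolding upper_def using \<theta>_pos f_nn by (intro prod_nonneg add_nonneg_nonneg ballI divide_nonneg_nonneg) auto

lemma upper_times_lower: "1 / 2 \<le> upper k * lower k" "upper k * lower k \<le> 1"
proof -
  have eq: "upper k * lower k = (\<Prod>l=k0..<k. 1 - \<theta>\<^sup>2 / (f l)\<^sup>2)"
    unfolding upper_def lower_def prod.distrib[symmetric]
    by (intro prod.cong refl) (simp add: algebra_simps power2_eq_square)
  have "1 / 2 \<le> 1 - (\<Sum>l=k0..<k. \<theta>\<^sup>2 / (f l)\<^sup>2)" using tail[of k] by simp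
  also have "\<dots> \<le> (\<Prod>l=k0..<k. 1 - \<theta>\<^sup>2 / (f l)\<^sup>2)"
    using factor_bounds(2) by (intro Weierstrass_prod_ineq) auto
  finally show "1 / 2 \<le> upper k * lower k" by (simp add: eq)
  show "upper k * lower k \<le> 1"
    unfolding eq using factor_bounds(2) by (intro prod_le_1) auto
qed

lemma upper_step:
  "(1 - f x / real n) * upper x + f x / n * upper (Suc x) \<le> upper x * (1 + \<theta> / n)"
proof (cases "k0 \<le> x")
  case True
  then have "upper (Suc x) = upper x * (1 + \<theta> / f x)"
    by (simp add: upper_def prod.atLeastLessThan_Suc)
  moreover have "(1 - p) * a + p * (a * (1 + u)) = a * (1 + p * u)" for p a u :: real
    by (simp add: algebra_simps)
  moreover have "f x / n * (\<theta> / f x) = \<theta> / n" using f_pos[of x] by simp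
  ultimately show ?thesis by (simp only: order.refl)
next
  case False
  then show ?thesis using \<theta>_pos by (simp add: upper_def)
qed

lemma lower_step:
  assumes "k0 \<le> y"
  shows "(1 - f y / real n) * lower y + f y / n * lower (Suc y) = lower y * (1 - \<theta> / n)"
proof -
  have "lower (Suc y) = lower y * (1 - \<theta> / f y)"
    using assms by (simp add: lower_def prod.atLeastLessThan_Suc)
  moreover have "(1 - p) * a + p * (a * (1 - u)) = a * (1 - p * u)" for p a u :: real
    by (simp add: algebra_simps)
  moreover have "f y / n * (\<theta> / f y) = \<theta> / n" using f_pos[of y] by simp
  ultimately show ?thesis by (simp only:)
qed

lemma indeg_until_le: "network_graph N H \<Longrightarrow> indeg_until n H j \<le> indeg H j"
  unfolding indeg_eq_card indeg_until_def
  by (rule card_mono) (use finite_subset[OF network_graph_heads[of N H j]] in auto)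

text \<open>
  The two degrees move independently, so the potential is multiplied by at most
  \<open>(1 + \<theta> / N) * (1 - \<theta> / N) \<le> 1\<close>.
\<close>

lemma potential_step:
  assumes H: "network_graph N H" and ij: "i \<in> {1..N}" "j \<in> {1..N}" "i \<noteq> j"
    and k0: "k0 \<le> indeg H j"
  shows "measure_pmf.expectation (attachment_step f N H) (\<lambda>H'. upper (indeg H' i) * lower (indeg H' j))
    \<le> upper (indeg H i) * lower (indeg H j)"
proof -
  let ?x = "indeg H i" and ?y = "indeg H j"
  let ?\<phi> = "\<lambda>l. if l = i then upper else lower"
  have lt: "?y < N" using indeg_le[OF H, of j] ij by auto
  have npos: "real N > 0" using ij by auto
  have "\<theta> \<le> f ?y" using \<theta>_le f_mono k0 by (meson mono_def order.trans)
  also have "\<dots> \<le> N" using prob_le_1[OF lt] npos by (simp add: divide_le_eq)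
  finally have \<theta>N: "\<theta> / N \<le> 1" using npos by (simp add: divide_le_eq)
  have "measure_pmf.expectation (attachment_step f N H) (\<lambda>H'. upper (indeg H' i) * lower (indeg H' j))
     = measure_pmf.expectation (attachment_step f N H) (\<lambda>H'. \<Prod>l\<in>{i, j}. ?\<phi> l (indeg H' l))"
    using ij by (intro Bochner_Integration.integral_cong) auto
  also have "\<dots> = ((1 - f ?x / N) * upper ?x + f ?x / N * upper (Suc ?x))
      * ((1 - f ?y / N) * lower ?y + f ?y / N * lower (Suc ?y))"
    using ij by (subst expectation_attachment_step[OF H]) (auto simp: upper_nonneg lower_nonneg)
  also have "\<dots> = ((1 - f ?x / N) * upper ?x + f ?x / N * upper (Suc ?x)) * (lower ?y * (1 - \<theta> / N))"
    using lower_step[OF k0] by simp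
  also have "\<dots> \<le> (upper ?x * (1 + \<theta> / N)) * (lower ?y * (1 - \<theta> / N))"
    using \<theta>N lower_nonneg upper_step by (intro mult_right_mono mult_nonneg_nonneg) auto
  also have "\<dots> = upper ?x * lower ?y * (1 - (\<theta> / N)\<^sup>2)"
    by (simp add: algebra_simps power2_eq_square)
  also have "\<dots> \<le> upper ?x * lower ?y * 1"
    using upper_nonneg lower_nonneg by (intro mult_left_mono) auto
  finally show ?thesis by simp
qed

text \<open>
  The supermartingale inequality for the potential stopped at the first meeting, where it is at least
  \<open>1 / 2\<close>. The event \<open>R\<close> is determined by the past up to time \<open>n\<close>: adding later vertices does not change it.
\<close>

theorem prob_meet_le:
  assumes ij: "i \<in> {1..n}" "j \<in> {1..n}" "i \<noteq> j" and nN: "n \<le> N"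
    and stable: "\<And>t S H. n \<le> t \<Longrightarrow> R (add_vertex t S H) = R H"
    and R: "\<And>t H. n \<le> t \<Longrightarrow> network_graph t H \<Longrightarrow> R H \<Longrightarrow> k0 \<le> indeg H j"
  shows "measure_pmf.prob (graph_law f N) {H. R H \<and> degrees_meet i j n N H}
    \<le> 2 * measure_pmf.expectation (graph_law f n)
        (\<lambda>H. if R H then upper (indeg H i) * lower (indeg H j) else 0)"
proof -
  let ?g = "\<lambda>H. upper (indeg H i) * lower (indeg H j)"
  \<comment> \<open>the stopped potential, with its value after the meeting lowered to \<open>1 / 2\<close>\<close>
  define \<psi> where "\<psi> N H = (if R H then if degrees_meet i j n N H then 1 / 2 else ?g H else 0)" for N H
  have \<psi>_le: "\<psi> N H \<le> (if R H then ?g H else 0)" if "n \<le> N" "network_graph N H"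
    and "degrees_meet i j n N H \<Longrightarrow> indeg_until N H i = indeg_until N H j" for N H
    using that upper_times_lower(1) by (auto simp: \<psi>_def indeg_eq_until)
  have descend: "measure_pmf.expectation (attachment_step f N H) (\<psi> (Suc N)) \<le> \<psi> N H"
    if N: "n \<le> N" and HN: "H \<in> set_pmf (graph_law f N)" for N H
  proof -
    have H: "network_graph N H" using HN by (rule network_graph_law)
    have meet_Suc: "degrees_meet i j n (Suc N) (add_vertex N S H) \<longleftrightarrow>
        degrees_meet i j n N H \<or> indeg_until (Suc N) (add_vertex N S H) i = indeg_until (Suc N) (add_vertex N S H) j"
      for S
      using N by (auto simp: degrees_meet_def atLeastAtMostSuc_conv indeg_until_add_vertex)
    show ?thesis
    proof (cases "R H \<and> \<not> degrees_meet i j n N H")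
      case True
      have "measure_pmf.expectation (attachment_step f N H) (\<psi> (Suc N))
          \<le> measure_pmf.expectation (attachment_step f N H) ?g"
      proof (rule integral_mono_AE)
        show "AE H' in attachment_step f N H. \<psi> (Suc N) H' \<le> ?g H'"
        proof (rule AE_pmfI)
          fix H' assume "H' \<in> set_pmf (attachment_step f N H)"
          then obtain S where S: "S \<subseteq> {1..N}" "H' = add_vertex N S H" using set_attachment_step by blast
          have "\<psi> (Suc N) H' \<le> (if R H' then ?g H' else 0)"
            using meet_Suc[of S] True network_graph_add_vertex[OF H S(1)] N
            by (intro \<psi>_le) (auto simp: S)
          also have "\<dots> = ?g H'" using True stable[OF N] by (simp add: S)
          finally show "\<psi> (Suc N) H' \<le> ?g H'" .
        qed
      qed auto
      also have "\<dots> \<le> ?g H"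
        using R[OF N H] True ij N by (intro potential_step[OF H]) auto
      also have "\<dots> = \<psi> N H" using True by (simp add: \<psi>_def)
      finally show ?thesis .
    next
      case False
      have "measure_pmf.expectation (attachment_step f N H) (\<psi> (Suc N))
          = measure_pmf.expectation (attachment_step f N H) (\<lambda>_. \<psi> N H)"
      proof (rule integral_cong_AE)
        show "AE H' in attachment_step f N H. \<psi> (Suc N) H' = \<psi> N H"
        proof (rule AE_pmfI)
          fix H' assume "H' \<in> set_pmf (attachment_step f N H)"
          then obtain S where S: "S \<subseteq> {1..N}" "H' = add_vertex N S H" using set_attachment_step by blast
          then show "\<psi> (Suc N) H' = \<psi> N H"
            using False stable[OF N] meet_Suc[of S] by (auto simp: \<psi>_def)
        qed
      qed auto
      then show ?thesis by simp
    qed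
  qed
  have "measure_pmf.expectation (graph_law f N) (\<psi> N) \<le> measure_pmf.expectation (graph_law f n) (\<psi> n)"
    using nN
  proof (induction N rule: dec_induct)
    case (step N)
    have "measure_pmf.expectation (graph_law f (Suc N)) (\<psi> (Suc N))
        \<le> measure_pmf.expectation (graph_law f N) (\<psi> N)"
      unfolding expectation_graph_law_Suc
      by (rule expectation_graph_law_mono) (rule descend[OF step.hyps(1)])
    then show ?case using step.IH by simp
  qed simp
  also have "\<dots> \<le> measure_pmf.expectation (graph_law f n) (\<lambda>H. if R H then ?g H else 0)"
    by (intro expectation_graph_law_mono \<psi>_le) (auto simp: degrees_meet_def network_graph_law)
  finally have 1: "measure_pmf.expectation (graph_law f N) (\<psi> N)
      \<le> measure_pmf.expectation (graph_law f n) (\<lambda>H. if R H then ?g H else 0)" .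
  have "measure_pmf.prob (graph_law f N) {H. R H \<and> degrees_meet i j n N H}
      = measure_pmf.expectation (graph_law f N) (indicator {H. R H \<and> degrees_meet i j n N H})" by simp
  also have "\<dots> \<le> measure_pmf.expectation (graph_law f N) (\<lambda>H. 2 * \<psi> N H)"
    using upper_nonneg lower_nonneg
    by (intro expectation_graph_law_mono) (auto simp: \<psi>_def indicator_def)
  also have "\<dots> = 2 * measure_pmf.expectation (graph_law f N) (\<psi> N)" by simp
  finally show ?thesis using 1 by simp
qed

definition weight :: "nat \<Rightarrow> nat \<Rightarrow> real" where "weight x y = (\<Prod>l=x..<y. 1 - \<theta> / f l)"

lemma weight_bounds: "k0 \<le> x \<Longrightarrow> 0 \<le> weight x y \<and> weight x y \<le> 1"
  unfolding weight_def using factor_bounds by (auto intro!: prod_nonneg prod_le_1)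

lemma upper_lower_le_weight:
  assumes "k0 \<le> x" "x \<le> y"
  shows "upper x * lower y \<le> weight x y"
proof -
  have "lower y = lower x * weight x y"
    unfolding lower_def weight_def using assms by (simp add: prod.atLeastLessThan_concat)
  then have "upper x * lower y = (upper x * lower x) * weight x y" by simp
  also have "\<dots> \<le> 1 * weight x y"
    using weight_bounds assms upper_times_lower(2) by (intro mult_right_mono) auto
  finally show ?thesis by simp
qed

text \<open>
  Discrete form of \<open>\<integral> exp (- \<theta> * u) du \<le> 1 / \<theta>\<close> over \<open>u \<ge> 0\<close>: the terms telescope because
  \<open>weight x y - weight x (Suc y) = \<theta> / f y * weight x y\<close>.
\<close>

lemma sum_weight_right:
  assumes "k0 \<le> x" "x \<le> n"
  shows "(\<Sum>y=x..<n. 1 / f y * weight x y) \<le> 1 / \<theta>"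
proof -
  have "\<theta> * (\<Sum>y=x..<n. 1 / f y * weight x y) = (\<Sum>y=x..<n. weight x y - weight x (Suc y))"
    unfolding sum_distrib_left
    by (intro sum.cong refl) (simp add: weight_def prod.atLeastLessThan_Suc algebra_simps)
  also have "\<dots> = weight x x - weight x n"
    using assms(2) by (induction n rule: dec_induct) auto
  also have "\<dots> \<le> 1" using weight_bounds[of x n] assms by (simp add: weight_def)
  finally show ?thesis using \<theta>_pos by (simp add: pos_le_divide_eq mult.commute)
qed

lemma sum_weight_left: "(\<Sum>y=k0..<x. 1 / f y * weight y x) \<le> 1 / \<theta>"
proof (cases "k0 \<le> x")
  case True
  have "\<theta> * (\<Sum>y=k0..<x. 1 / f y * weight y x) \<le> (\<Sum>y=k0..<x. weight (Suc y) x - weight y x)"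
    unfolding sum_distrib_left
  proof (intro sum_mono)
    fix y assume y: "y \<in> {k0..<x}"
    then have eq: "weight y x = (1 - \<theta> / f y) * weight (Suc y) x"
      by (simp add: weight_def prod.atLeast_Suc_lessThan)
    have "0 \<le> weight (Suc y) x" using weight_bounds[of "Suc y" x] y by simp
    then have "weight y x \<le> weight (Suc y) x"
      using factor_bounds(1)[of y] y unfolding eq by (intro mult_left_le_one_le) auto
    then have "\<theta> / f y * weight y x \<le> \<theta> / f y * weight (Suc y) x"
      using \<theta>_pos f_nn by (intro mult_left_mono) auto
    moreover have "weight (Suc y) x - weight y x = \<theta> / f y * weight (Suc y) x"
      unfolding eq by (simp add: algebra_simps)
    ultimately show "\<theta> * (1 / f y * weight y x) \<le> weight (Suc y) x - weight y x" by simp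
  qed
  also have "\<dots> = weight x x - weight k0 x"
    using True by (simp add: sum_Suc_diff'[of k0 x "\<lambda>y. weight y x"])
  also have "\<dots> \<le> 1" using weight_bounds[of k0 x] by (simp add: weight_def)
  finally show ?thesis using \<theta>_pos by (simp add: pos_le_divide_eq mult.commute)
qed (use \<theta>_pos in simp)

end

context attachment
begin

lemma expectation_degree_pair:
  assumes ij: "i \<in> {1..n}" "j \<in> {1..n}" "i \<noteq> j"
  shows "measure_pmf.expectation (graph_law f n) (\<lambda>H. g (indeg H i) (indeg H j))
    = (\<Sum>x<n. \<Sum>y<n. degree_law f i n x * degree_law f j n y * g x y)"
proof -
  let ?\<phi> = "\<lambda>x y l k. if l = i then of_bool (k = x) else of_bool (k = y) :: real"
  have "measure_pmf.expectation (graph_law f n) (\<lambda>H. g (indeg H i) (indeg H j))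
      = measure_pmf.expectation (graph_law f n)
          (\<lambda>H. \<Sum>x<n. \<Sum>y<n. g x y * (\<Prod>l\<in>{i, j}. ?\<phi> x y l (indeg H l)))"
  proof (rule expectation_graph_law_cong)
    fix H assume "H \<in> set_pmf (graph_law f n)"
    then have "indeg H i < n" "indeg H j < n"
      using indeg_le[OF network_graph_law, of H f n] ij by (force intro: le_less_trans)+
    then show "g (indeg H i) (indeg H j)
        = (\<Sum>x<n. \<Sum>y<n. g x y * (\<Prod>l\<in>{i, j}. ?\<phi> x y l (indeg H l)))"
      using ij by (simp add: of_bool_def if_distrib[of "(*) _"] if_distrib[of "\<lambda>z. z * _"] cong: if_cong)
  qed
  also have "\<dots> = (\<Sum>x<n. \<Sum>y<n. g x y * (\<Prod>l\<in>{i, j}. \<Sum>k<n. degree_law f l n k * ?\<phi> x y l k))"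
    by (simp only: Bochner_Integration.integral_sum integrable_graph_law integral_mult_right_zero)
       (use ij in \<open>intro sum.cong refl arg_cong2[where f = "(*)"] expectation_prod_degrees; auto\<close>)
  also have "\<dots> = (\<Sum>x<n. \<Sum>y<n. degree_law f i n x * degree_law f j n y * g x y)"
    using ij by (intro sum.cong refl)
      (simp add: of_bool_def if_distrib[of "(*) _"] cong: if_cong)
  finally show ?thesis .
qed

end

context meeting
begin

text \<open>
  Given the degree of \<open>i\<close>, the degree of \<open>j\<close> takes each value \<open>y\<close> with probability at most \<open>1 / f y\<close>.
  Averaging the bound of \<open>prob_meet_le\<close> over \<open>y\<close> gives the two sums of weights above, one for each order
  of the degrees at time \<open>n\<close>.
\<close>

lemma prob_meet_late:
  assumes ij: "1 \<le> i" "i < j" "j \<le> n" "n \<le> N"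
  shows "measure_pmf.prob (graph_law f N)
      {H. (k0 \<le> indeg_until n H i \<and> indeg_until n H i \<le> indeg_until n H j) \<and> degrees_meet i j n N H}
      \<le> 2 / \<theta>"
    and "measure_pmf.prob (graph_law f N)
      {H. (k0 \<le> indeg_until n H j \<and> indeg_until n H j < indeg_until n H i) \<and> degrees_meet i j n N H}
      \<le> 2 / \<theta>"
proof -
  have mem: "i \<in> {1..n}" "j \<in> {1..n}" "i \<noteq> j" using ij by auto
  have q_le: "degree_law f j n y * w \<le> 1 / f y * w" if "0 \<le> w" for y w
    using f_degree_law_le[of j y n] f_pos[of y] ij that
    by (intro mult_right_mono) (auto simp: pos_le_divide_eq mult.commute)
  have average: "measure_pmf.expectation (graph_law f n) (\<lambda>H. g (indeg H i) (indeg H j)) \<le> 1 / \<theta>"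
    if g: "\<And>x. x < n \<Longrightarrow> (\<Sum>y<n. 1 / f y * g x y) \<le> 1 / \<theta>" "\<And>x y. 0 \<le> g x y" for g
  proof -
    have "measure_pmf.expectation (graph_law f n) (\<lambda>H. g (indeg H i) (indeg H j))
        = (\<Sum>x<n. degree_law f i n x * (\<Sum>y<n. degree_law f j n y * g x y))"
      by (simp add: expectation_degree_pair[OF mem] sum_distrib_left mult.assoc)
    also have "\<dots> \<le> (\<Sum>x<n. degree_law f i n x * (1 / \<theta>))"
    proof (intro sum_mono mult_left_mono)
      fix x assume "x \<in> {..<n}"
      have "(\<Sum>y<n. degree_law f j n y * g x y) \<le> (\<Sum>y<n. 1 / f y * g x y)"
        using q_le g(2) by (intro sum_mono) auto
      also have "\<dots> \<le> 1 / \<theta>" using g(1) \<open>x \<in> _\<close> by simp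
      finally show "(\<Sum>y<n. degree_law f j n y * g x y) \<le> 1 / \<theta>" .
    qed (use degree_law_nonneg ij in auto)
    also have "\<dots> = 1 / \<theta>"
      using degree_law_sum[of i n] ij by (simp add: sum_divide_distrib[symmetric])
    finally show ?thesis .
  qed
  let ?g1 = "\<lambda>x y. if k0 \<le> x \<and> x \<le> y then weight x y else 0"
  let ?g2 = "\<lambda>x y. if k0 \<le> y \<and> y < x then weight y x else 0"
  have g_nn: "0 \<le> ?g1 x y" "0 \<le> ?g2 x y" for x y using weight_bounds by auto
  have g1: "(\<Sum>y<n. 1 / f y * ?g1 x y) \<le> 1 / \<theta>" if "x < n" for x
  proof (cases "k0 \<le> x")
    case True
    have "(\<Sum>y<n. 1 / f y * ?g1 x y) = (\<Sum>y=x..<n. 1 / f y * weight x y)"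
      using True by (intro sum.mono_neutral_cong_right) auto
    then show ?thesis using sum_weight_right[of x n] True that by simp
  qed (use \<theta>_pos in simp)
  have g2: "(\<Sum>y<n. 1 / f y * ?g2 x y) \<le> 1 / \<theta>" if "x < n" for x
  proof -
    have "(\<Sum>y<n. 1 / f y * ?g2 x y) = (\<Sum>y=k0..<x. 1 / f y * weight y x)"
      using that by (intro sum.mono_neutral_cong_right) auto
    then show ?thesis using sum_weight_left[of x] by simp
  qed
  let ?R1 = "\<lambda>H. k0 \<le> indeg_until n H i \<and> indeg_until n H i \<le> indeg_until n H j"
  let ?R2 = "\<lambda>H. k0 \<le> indeg_until n H j \<and> indeg_until n H j < indeg_until n H i"
  have "measure_pmf.prob (graph_law f N) {H. ?R1 H \<and> degrees_meet i j n N H}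
      \<le> 2 * measure_pmf.expectation (graph_law f n)
          (\<lambda>H. if ?R1 H then upper (indeg H i) * lower (indeg H j) else 0)"
  proof (rule prob_meet_le)
    fix t H assume "network_graph t H" "?R1 H"
    then show "k0 \<le> indeg H j" using indeg_until_le[of t H n j] by linarith
  qed (use mem ij in \<open>auto simp: indeg_until_add_vertex\<close>)
  also have "\<dots> \<le> 2 * measure_pmf.expectation (graph_law f n) (\<lambda>H. ?g1 (indeg H i) (indeg H j))"
  proof (intro mult_left_mono expectation_graph_law_mono)
    fix H assume "H \<in> set_pmf (graph_law f n)"
    then have "indeg_until n H l = indeg H l" for l
      by (intro indeg_eq_until network_graph_law)
    then show "(if ?R1 H then upper (indeg H i) * lower (indeg H j) else 0) \<le> ?g1 (indeg H i) (indeg H j)"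
      using upper_lower_le_weight[of "indeg H i" "indeg H j"] by simp
  qed simp
  also have "\<dots> \<le> 2 * (1 / \<theta>)" by (intro mult_left_mono average g1 g_nn) auto
  finally show "measure_pmf.prob (graph_law f N) {H. ?R1 H \<and> degrees_meet i j n N H} \<le> 2 / \<theta>" by simp
  have sym: "degrees_meet i j n N H = degrees_meet j i n N H" for H
    unfolding degrees_meet_def by metis
  have "measure_pmf.prob (graph_law f N) {H. ?R2 H \<and> degrees_meet j i n N H}
      \<le> 2 * measure_pmf.expectation (graph_law f n)
          (\<lambda>H. if ?R2 H then upper (indeg H j) * lower (indeg H i) else 0)"
  proof (rule prob_meet_le)
    fix t H assume "network_graph t H" "?R2 H"
    then show "k0 \<le> indeg H i" using indeg_until_le[of t H n i] by linarith
  qed (use mem ij in \<open>auto simp: indeg_until_add_vertex\<close>)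
  also have "\<dots> \<le> 2 * measure_pmf.expectation (graph_law f n) (\<lambda>H. ?g2 (indeg H i) (indeg H j))"
  proof (intro mult_left_mono expectation_graph_law_mono)
    fix H assume "H \<in> set_pmf (graph_law f n)"
    then have "indeg_until n H l = indeg H l" for l
      by (intro indeg_eq_until network_graph_law)
    then show "(if ?R2 H then upper (indeg H j) * lower (indeg H i) else 0) \<le> ?g2 (indeg H i) (indeg H j)"
      using upper_lower_le_weight[of "indeg H j" "indeg H i"] by simp
  qed simp
  also have "\<dots> \<le> 2 * (1 / \<theta>)" by (intro mult_left_mono average g2 g_nn) auto
  finally show "measure_pmf.prob (graph_law f N) {H. ?R2 H \<and> degrees_meet i j n N H} \<le> 2 / \<theta>"
    by (simp add: sym)
qed

text \<open>
  At its birth at time \<open>j\<close> the newcomer has degree \<open>0\<close>, and the potential reduces to \<open>lower\<close> of the degree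
  of vertex \<open>1\<close>. From time \<open>s\<close> on its expectation shrinks by the factors \<open>1 - 2 / n \<le> (n / (n + 1))\<^sup>2\<close>. The
  exponent \<open>\<theta> = 2\<close> makes the bound summable in \<open>j\<close>.
\<close>

lemma prob_newcomer_meets_le:
  assumes \<theta>: "\<theta> = 2" and s: "2 \<le> s" "s \<le> j" "j \<le> N"
  shows "measure_pmf.prob (graph_law f N) {H. k0 \<le> indeg_until s H 1 \<and> degrees_meet j 1 j N H}
    \<le> 2 * (s / j)\<^sup>2"
proof -
  let ?R = "\<lambda>H. k0 \<le> indeg_until s H 1"
  let ?E = "\<lambda>n. measure_pmf.expectation (graph_law f n) (\<lambda>H. if ?R H then lower (indeg H 1) else 0)"
  have decay: "?E n \<le> (s / n)\<^sup>2" if "s \<le> n" for n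
    using that
  proof (induction n rule: dec_induct)
    case base
    have "?E s \<le> measure_pmf.expectation (graph_law f s) (\<lambda>_. 1)"
      using lower_le_1 by (intro expectation_graph_law_mono) auto
    then show ?case using s by simp
  next
    case (step n)
    have npos: "real n \<ge> 2" using step s by simp
    have one: "measure_pmf.expectation (attachment_step f n H) (\<lambda>H'. if ?R H' then lower (indeg H' 1) else 0)
        = (1 - 2 / n) * (if ?R H then lower (indeg H 1) else 0)"
      if HH: "H \<in> set_pmf (graph_law f n)" for H
    proof -
      have H: "network_graph n H" using HH by (rule network_graph_law)
      have "measure_pmf.expectation (attachment_step f n H) (\<lambda>H'. if ?R H' then lower (indeg H' 1) else 0)
          = measure_pmf.expectation (attachment_step f n H)
              (\<lambda>H'. of_bool (?R H) * (\<Prod>l\<in>{1}. lower (indeg H' l)))"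
      proof (rule integral_cong_AE)
        show "AE H' in attachment_step f n H. (if ?R H' then lower (indeg H' 1) else 0)
            = of_bool (?R H) * (\<Prod>l\<in>{1}. lower (indeg H' l))"
        proof (rule AE_pmfI)
          fix H' assume "H' \<in> set_pmf (attachment_step f n H)"
          then obtain S where "H' = add_vertex n S H" using set_attachment_step by blast
          then show "(if ?R H' then lower (indeg H' 1) else 0)
              = of_bool (?R H) * (\<Prod>l\<in>{1}. lower (indeg H' l))"
            using step.hyps by (simp add: indeg_until_add_vertex)
        qed
      qed auto
      also have "\<dots> = of_bool (?R H) * ((1 - f (indeg H 1) / n) * lower (indeg H 1)
          + f (indeg H 1) / n * lower (Suc (indeg H 1)))"
        using npos by (subst integral_mult_right_zero, subst expectation_attachment_step[OF H])
          (auto simp: lower_nonneg)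
      also have "\<dots> = (1 - 2 / n) * (if ?R H then lower (indeg H 1) else 0)"
      proof (cases "?R H")
        case True
        then have "k0 \<le> indeg H 1" using indeg_until_le[OF H, of s 1] by simp
        then show ?thesis using lower_step[of "indeg H 1" n] True by (simp add: \<theta> mult.commute)
      qed simp
      finally show ?thesis .
    qed
    have "?E (Suc n) = measure_pmf.expectation (graph_law f n)
        (\<lambda>H. (1 - 2 / n) * (if ?R H then lower (indeg H 1) else 0))"
      unfolding expectation_graph_law_Suc by (rule expectation_graph_law_cong) (rule one)
    also have "\<dots> = (1 - 2 / n) * ?E n" by (rule integral_mult_right_zero)
    also have "\<dots> \<le> (1 - 2 / n) * (s / n)\<^sup>2"
      using step.IH npos by (intro mult_left_mono) auto
    also have "\<dots> \<le> (n / Suc n)\<^sup>2 * (s / n)\<^sup>2"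
    proof (intro mult_right_mono)
      have "(real n - 2) * (real n + 1)\<^sup>2 = real n ^ 3 - 3 * real n - 2"
        by (simp add: power2_eq_square power3_eq_cube algebra_simps)
      then have "(real n - 2) * (real n + 1)\<^sup>2 \<le> real n ^ 3" using npos by simp
      then have "(real n - 2) \<le> real n ^ 3 / (real n + 1)\<^sup>2" using npos by (simp add: pos_le_divide_eq)
      then have "(real n - 2) / n \<le> real n ^ 3 / (real n + 1)\<^sup>2 / n"
        using npos by (intro divide_right_mono) auto
      then show "1 - 2 / real n \<le> (n / Suc n)\<^sup>2"
        using npos by (simp add: diff_divide_distrib power_divide power2_eq_square power3_eq_cube add.commute)
    qed simp
    also have "\<dots> = (s / Suc n)\<^sup>2" using npos by (simp add: power_divide)
    finally show ?case .
  qed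
  have "measure_pmf.prob (graph_law f N) {H. ?R H \<and> degrees_meet j 1 j N H}
      \<le> 2 * measure_pmf.expectation (graph_law f j)
          (\<lambda>H. if ?R H then upper (indeg H j) * lower (indeg H 1) else 0)"
  proof (rule prob_meet_le)
    fix t H assume "network_graph t H" "?R H"
    then show "k0 \<le> indeg H 1" using indeg_until_le[of t H s 1] by linarith
  qed (use s in \<open>auto simp: indeg_until_add_vertex\<close>)
  also have "\<dots> = 2 * ?E j"
  proof (intro arg_cong2[where f = "(*)"] refl expectation_graph_law_cong)
    fix H assume "H \<in> set_pmf (graph_law f j)"
    then have "indeg H j = 0" using indeg_le[OF network_graph_law, of H f j j] by simp
    then show "(if ?R H then upper (indeg H j) * lower (indeg H 1) else 0)
        = (if ?R H then lower (indeg H 1) else 0)"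
      by (simp add: upper_def)
  qed
  also have "\<dots> \<le> 2 * (s / j)\<^sup>2" using decay[OF s(2)] by simp
  finally show ?thesis .
qed

end

lemma (in attachment) exists_meeting_level:
  assumes sm: "summable (\<lambda>k. 1 / (f k)\<^sup>2)" and \<theta>: "\<theta> > 0"
  shows "\<exists>k0. meeting f \<theta> k0"
proof -
  have "1 / (2 * \<theta>\<^sup>2) > 0" using \<theta> by simp
  then obtain k0 where k0: "\<And>m n. k0 \<le> m \<Longrightarrow> norm (\<Sum>l=m..<n. 1 / (f l)\<^sup>2) < 1 / (2 * \<theta>\<^sup>2)"
    using sm[unfolded summable_Cauchy] by meson
  have tail: "(\<Sum>l=k0..<k. \<theta>\<^sup>2 / (f l)\<^sup>2) \<le> 1 / 2" for k
  proof -
    have "(\<Sum>l=k0..<k. \<theta>\<^sup>2 / (f l)\<^sup>2) = \<theta>\<^sup>2 * (\<Sum>l=k0..<k. 1 / (f l)\<^sup>2)"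
      by (simp add: sum_distrib_left)
    also have "\<dots> \<le> \<theta>\<^sup>2 * (1 / (2 * \<theta>\<^sup>2))"
      using k0[of k0 k] by (intro mult_left_mono) (auto simp: abs_less_iff)
    finally show ?thesis using \<theta> by simp
  qed
  have "\<theta>\<^sup>2 / (f k0)\<^sup>2 \<le> 1 / 2" using tail[of "Suc k0"] by simp
  then have "\<theta>\<^sup>2 \<le> (f k0)\<^sup>2 / 2" using f_pos[of k0] by (simp add: pos_divide_le_eq)
  then have "\<theta>\<^sup>2 \<le> (f k0)\<^sup>2" using zero_le_power2[of "f k0"] by linarith
  then have "\<theta> \<le> f k0" using f_nn by (rule power2_le_imp_le)
  then show ?thesis using \<theta> tail by (intro exI[of _ k0]) (unfold_locales, auto)
qed

section \<open>Growing graphs and the persistent hub\<close>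

definition consistent_growth :: "(nat \<Rightarrow> nat pair_pre_digraph) \<Rightarrow> bool" where
  "consistent_growth g \<longleftrightarrow>
     (\<forall>n\<ge>1. network_graph n (g n) \<and> (\<exists>S\<subseteq>{1..n}. g (Suc n) = add_vertex n S (g n)))"

lemma growth_graph: "consistent_growth g \<Longrightarrow> 1 \<le> n \<Longrightarrow> network_graph n (g n)"
  by (simp add: consistent_growth_def)

lemma growth_step:
  assumes "consistent_growth g" "1 \<le> n"
  obtains S where "S \<subseteq> {1..n}" "g (Suc n) = add_vertex n S (g n)"
  using assms by (auto simp: consistent_growth_def)

lemma growth_indeg_until:
  assumes g: "consistent_growth g" and t: "1 \<le> t" "t \<le> n"
  shows "indeg_until t (g n) m = indeg (g t) m"
  using t(2)
proof (induction n rule: dec_induct)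
  case base then show ?case by (rule indeg_eq_until[OF growth_graph[OF g t(1)]])
next
  case (step n)
  then have "1 \<le> n" using t by simp
  then obtain S where "g (Suc n) = add_vertex n S (g n)" using growth_step[OF g] by blast
  then show ?case using step by (simp add: indeg_until_add_vertex)
qed

lemma growth_indeg_Suc:
  assumes "consistent_growth g" "1 \<le> n"
  shows "indeg (g n) m \<le> indeg (g (Suc n)) m \<and> indeg (g (Suc n)) m \<le> Suc (indeg (g n) m)"
proof -
  obtain S where S: "g (Suc n) = add_vertex n S (g n)" using growth_step[OF assms] by blast
  show ?thesis unfolding S indeg_add_vertex[OF growth_graph[OF assms]] by simp
qed

text \<open>
  Degrees grow by at most one at a time, so they cannot cross without meeting.
\<close>

lemma growth_order_persists:
  assumes g: "consistent_growth g" and T: "1 \<le> T" "T \<le> t"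
    and ne: "\<And>t. T \<le> t \<Longrightarrow> indeg (g t) i \<noteq> indeg (g t) j"
    and less: "indeg (g T) i < indeg (g T) j"
  shows "indeg (g t) i < indeg (g t) j"
  using T(2)
proof (induction t rule: dec_induct)
  case base show ?case by (rule less)
next
  case (step t)
  have "1 \<le> t" using step T by simp
  then show ?case
    using growth_indeg_Suc[OF g, of t i] growth_indeg_Suc[OF g, of t j] step ne[of "Suc t"] by linarith
qed

text \<open>
  Vertices above \<open>J\<close> are born below vertex \<open>1\<close> and stay there. The finitely many others are
  eventually in a fixed strict order, and the first of them in this order is the hub.
\<close>

lemma persistent_hub_if_finitely_many_rivals:
  assumes g: "consistent_growth g"
    and pairs: "\<And>i j. 1 \<le> i \<Longrightarrow> i < j \<Longrightarrow> \<exists>T. \<forall>t\<ge>T. indeg (g t) i \<noteq> indeg (g t) j"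
    and late: "\<And>j t. J \<le> j \<Longrightarrow> j \<le> t \<Longrightarrow> indeg (g t) j \<noteq> indeg (g t) 1"
  shows "\<exists>m. persistent_hub g m"
proof -
  have "\<forall>i j. \<exists>T. 1 \<le> i \<longrightarrow> 1 \<le> j \<longrightarrow> i \<noteq> j \<longrightarrow> (\<forall>t\<ge>T. indeg (g t) i \<noteq> indeg (g t) j)"
    using pairs by (metis linorder_neqE_nat)
  then obtain T where T: "\<And>i j t. 1 \<le> i \<Longrightarrow> 1 \<le> j \<Longrightarrow> i \<noteq> j \<Longrightarrow> T i j \<le> t \<Longrightarrow> indeg (g t) i \<noteq> indeg (g t) j"
    by metis
  \<comment> \<open>the successor puts vertex \<open>1\<close> among the candidates\<close>
  define K where "K = Suc J"
  define T0 where "T0 = Max (insert K ((\<lambda>(i, j). T i j) ` ({1..K} \<times> {1..K})))"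
  have T0: "K \<le> T0" "\<And>i j. i \<in> {1..K} \<Longrightarrow> j \<in> {1..K} \<Longrightarrow> T i j \<le> T0"
    unfolding T0_def by (rule Max_ge; force)+
  have T01: "1 \<le> T0" using T0(1) by (simp add: K_def)
  obtain m where m: "m \<in> {1..K}" "\<And>i. i \<in> {1..K} \<Longrightarrow> indeg (g T0) i \<le> indeg (g T0) m"
  proof -
    have fin: "finite {1..K}" "{1..K} \<noteq> {}" by (auto simp: K_def)
    let ?Z = "indeg (g T0) ` {1..K}"
    have "Max ?Z \<in> ?Z" using fin by (intro Max_in) auto
    then obtain m where "m \<in> {1..K}" "indeg (g T0) m = Max ?Z" by auto
    then show ?thesis using that[of m] fin by (simp add: Max_ge)
  qed
  have old: "indeg (g t) i \<le> indeg (g t) m" if i: "i \<in> {1..K}" and t: "T0 \<le> t" for i t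
  proof (cases "i = m")
    case False
    have ne: "indeg (g t) i \<noteq> indeg (g t) m" if "T0 \<le> t" for t
      using T[of i m t] T0(2)[of i m] i m(1) False that by auto
    have "indeg (g T0) i < indeg (g T0) m" using m(2)[OF i] ne[of T0] by simp
    then show ?thesis using growth_order_persists[OF g T01 t ne] by simp
  qed simp
  have new: "indeg (g t) j < indeg (g t) 1" if j: "K < j" and t: "j \<le> t" for j t
  proof (rule growth_order_persists[OF g _ t])
    show "indeg (g t) j \<noteq> indeg (g t) 1" if "j \<le> t" for t
      using late[of j t] j that by (simp add: K_def)
    have "indeg (g j) j = 0" using indeg_le[OF growth_graph[OF g, of j], of j] j by simp
    then show "indeg (g j) j < indeg (g j) 1" using late[of j j] j by (simp add: K_def)
  qed (use j in simp)
  have "has_max_indegree (g t) m" if t: "T0 \<le> t" for t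
  proof -
    have t1: "1 \<le> t" using t T01 by simp
    have verts: "pverts (g t) = {1..t}" using growth_graph[OF g t1] by (simp add: network_graph_def)
    have "indeg (g t) j \<le> indeg (g t) m" if "j \<in> {1..t}" for j
    proof (cases "j \<le> K")
      case True then show ?thesis using old t that by simp
    next
      case False
      then have "indeg (g t) j < indeg (g t) 1" using new that by simp
      also have "\<dots> \<le> indeg (g t) m" using old[of 1 t] t by (simp add: K_def)
      finally show ?thesis by simp
    qed
    moreover have "m \<in> {1..t}" using m(1) T0(1) t by simp
    ultimately show ?thesis
      unfolding has_max_indegree_def verts by (auto intro!: Max_eqI[symmetric])
  qed
  then show ?thesis unfolding persistent_hub_def eventually_sequentially by blast
qed

section \<open>Transfer to an arbitrary realisation of the network\<close>

context attachment_network
begin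

lemma graph_event [measurable]: "n \<ge> 1 \<Longrightarrow> {\<omega> \<in> space M. P (G n \<omega>)} \<in> events"
  using measurable_sets[OF graph_measurable, of n "{H. P H}"]
  by (simp add: vimage_def Int_def conj_commute)

text \<open>
  Conditional probabilities are prescribed only for graphs of positive probability. By induction the
  finite set \<open>set_pmf (graph_law f n)\<close> carries all the mass, so the next step is a finite sum over
  such graphs.
\<close>

lemma prob_graph_eq: "n \<ge> 1 \<Longrightarrow> prob {\<omega> \<in> space M. G n \<omega> = H} = pmf (graph_law f n) H"
  and AE_graph_support: "n \<ge> 1 \<Longrightarrow> AE \<omega> in M. G n \<omega> \<in> set_pmf (graph_law f n)"
proof -
  have supp: "AE \<omega> in M. G n \<omega> \<in> set_pmf (graph_law f n)"
    if n: "n \<ge> 1" and eq: "\<And>H. prob {\<omega> \<in> space M. G n \<omega> = H} = pmf (graph_law f n) H" for n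
  proof -
    let ?X = "set_pmf (graph_law f n)"
    have "prob {\<omega> \<in> space M. G n \<omega> \<in> ?X} = prob (\<Union>H\<in>?X. {\<omega> \<in> space M. G n \<omega> = H})"
      by (rule arg_cong[where f = prob]) auto
    also have "\<dots> = (\<Sum>H\<in>?X. prob {\<omega> \<in> space M. G n \<omega> = H})"
      using n by (intro finite_measure_finite_Union) (auto simp: disjoint_family_on_def)
    also have "\<dots> = 1" by (simp add: eq sum_pmf_eq_1)
    finally show ?thesis by (simp only: prob_Collect_eq_1[OF graph_event[OF n, of "\<lambda>H. H \<in> ?X"]])
  qed
  have main: "\<forall>H. prob {\<omega> \<in> space M. G n \<omega> = H} = pmf (graph_law f n) H" if "n \<ge> 1" for n
    using that
  proof (induction n rule: nat_induct_at_least)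
    case base
    show ?case
    proof
      fix H
      have "prob {\<omega> \<in> space M. G 1 \<omega> = H} = prob {\<omega> \<in> space M. initial_graph = H}"
        by (rule prob_eq_AE) (use graph_initial in auto)
      also have "\<dots> = pmf (graph_law f 1) H"
        unfolding graph_law_1 by (cases "H = initial_graph") (auto simp: prob_space)
      finally show "prob {\<omega> \<in> space M. G 1 \<omega> = H} = pmf (graph_law f 1) H" .
    qed
  next
    case (Suc n)
    let ?X = "set_pmf (graph_law f n)"
    show ?case
    proof
      fix H'
      have "prob {\<omega> \<in> space M. G (Suc n) \<omega> = H'}
          = prob (\<Union>H\<in>?X. {\<omega> \<in> space M. G (Suc n) \<omega> = H' \<and> G n \<omega> = H})"
      proof (rule finite_measure_eq_AE)
        show "AE \<omega> in M. \<omega> \<in> {\<omega> \<in> space M. G (Suc n) \<omega> = H'} \<longleftrightarrow>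
            \<omega> \<in> (\<Union>H\<in>?X. {\<omega> \<in> space M. G (Suc n) \<omega> = H' \<and> G n \<omega> = H})"
          using supp[OF Suc.hyps] Suc.IH by auto
      qed (use Suc.hyps in \<open>auto intro!: sets.finite_UN sets.sets_Collect_conj\<close>)
      also have "\<dots> = (\<Sum>H\<in>?X. prob {\<omega> \<in> space M. G (Suc n) \<omega> = H' \<and> G n \<omega> = H})"
        using Suc.hyps
        by (intro finite_measure_finite_Union) (auto simp: disjoint_family_on_def intro!: sets.sets_Collect_conj)
      also have "\<dots> = (\<Sum>H\<in>?X. pmf (graph_law f n) H * pmf (attachment_step f n H) H')"
      proof (intro sum.cong refl)
        fix H assume H: "H \<in> ?X"
        then have pos: "prob {\<omega> \<in> space M. G n \<omega> = H} > 0" using Suc.IH by (simp add: pmf_positive)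
        show "prob {\<omega> \<in> space M. G (Suc n) \<omega> = H' \<and> G n \<omega> = H}
            = pmf (graph_law f n) H * pmf (attachment_step f n H) H'"
          using graph_step[OF Suc.hyps pos, of H'] pos Suc.IH by (simp add: cond_prob_def field_simps)
      qed
      also have "\<dots> = measure_pmf.expectation (graph_law f n) (\<lambda>H. pmf (attachment_step f n H) H')"
        by (subst integral_measure_pmf[of ?X]) auto
      also have "\<dots> = pmf (graph_law f (Suc n)) H'" by (simp add: pmf_bind)
      finally show "prob {\<omega> \<in> space M. G (Suc n) \<omega> = H'} = pmf (graph_law f (Suc n)) H'" .
    qed
  qed
  show "prob {\<omega> \<in> space M. G n \<omega> = H} = pmf (graph_law f n) H" if "n \<ge> 1"
    using main[OF that] by blast
  show "AE \<omega> in M. G n \<omega> \<in> set_pmf (graph_law f n)" if "n \<ge> 1"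
    using supp[OF that] main[OF that] by blast
qed

lemma prob_graph:
  assumes n: "n \<ge> 1"
  shows "prob {\<omega> \<in> space M. P (G n \<omega>)} = measure_pmf.prob (graph_law f n) {H. P H}"
proof -
  let ?X = "set_pmf (graph_law f n) \<inter> {H. P H}"
  have "prob {\<omega> \<in> space M. P (G n \<omega>)} = prob (\<Union>H\<in>?X. {\<omega> \<in> space M. G n \<omega> = H})"
  proof (rule finite_measure_eq_AE)
    show "AE \<omega> in M. \<omega> \<in> {\<omega> \<in> space M. P (G n \<omega>)} \<longleftrightarrow> \<omega> \<in> (\<Union>H\<in>?X. {\<omega> \<in> space M. G n \<omega> = H})"
      using AE_graph_support[OF n] by auto
  qed (use n in \<open>auto intro!: sets.finite_UN\<close>)
  also have "\<dots> = (\<Sum>H\<in>?X. prob {\<omega> \<in> space M. G n \<omega> = H})"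
    using n by (intro finite_measure_finite_Union) (auto simp: disjoint_family_on_def)
  also have "\<dots> = (\<Sum>H\<in>?X. pmf (graph_law f n) H)" using n by (simp add: prob_graph_eq)
  also have "\<dots> = measure_pmf.prob (graph_law f n) ?X" by (simp add: measure_measure_pmf_finite)
  also have "\<dots> = measure_pmf.prob (graph_law f n) {H. P H}"
    by (rule measure_pmf.finite_measure_eq_AE) (auto intro: AE_pmfI)
  finally show ?thesis .
qed

lemma AE_consistent_growth: "AE \<omega> in M. consistent_growth (\<lambda>n. G n \<omega>)"
proof -
  have step: "AE \<omega> in M. G (Suc n) \<omega> \<in> set_pmf (attachment_step f n (G n \<omega>))" if n: "n \<ge> 1" for n
  proof -
    have "AE \<omega> in M. \<forall>H\<in>set_pmf (graph_law f n). \<forall>H'\<in>set_pmf (graph_law f (Suc n)).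
        H' \<notin> set_pmf (attachment_step f n H) \<longrightarrow> \<not> (G (Suc n) \<omega> = H' \<and> G n \<omega> = H)"
    proof (intro AE_finite_allI finite_set_graph_law)
      fix H H' assume H: "H \<in> set_pmf (graph_law f n)"
      show "AE \<omega> in M. H' \<notin> set_pmf (attachment_step f n H) \<longrightarrow> \<not> (G (Suc n) \<omega> = H' \<and> G n \<omega> = H)"
      proof (cases "H' \<in> set_pmf (attachment_step f n H)")
        case False
        have pos: "prob {\<omega> \<in> space M. G n \<omega> = H} > 0"
          using H n by (simp add: prob_graph_eq pmf_positive)
        have "pmf (attachment_step f n H) H' = 0" using False by (simp add: set_pmf_iff)
        then have "prob {\<omega> \<in> space M. G (Suc n) \<omega> = H' \<and> G n \<omega> = H} = 0"
          using graph_step[OF n pos, of H'] pos by (simp add: cond_prob_def)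
        then have "AE \<omega> in M. \<not> (G (Suc n) \<omega> = H' \<and> G n \<omega> = H)"
          using n by (subst (asm) prob_Collect_eq_0) (auto intro!: sets.sets_Collect_conj)
        then show ?thesis by simp
      qed simp
    qed
    with AE_graph_support[OF n] AE_graph_support[of "Suc n"] show ?thesis by auto
  qed
  have "AE \<omega> in M. \<forall>n. n \<ge> 1 \<longrightarrow> G n \<omega> \<in> set_pmf (graph_law f n)
      \<and> G (Suc n) \<omega> \<in> set_pmf (attachment_step f n (G n \<omega>))"
    unfolding AE_all_countable
  proof
    fix n show "AE \<omega> in M. n \<ge> 1 \<longrightarrow> G n \<omega> \<in> set_pmf (graph_law f n)
      \<and> G (Suc n) \<omega> \<in> set_pmf (attachment_step f n (G n \<omega>))"
      using step[of n] AE_graph_support[of n] by (cases "n \<ge> 1") auto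
  qed
  then show ?thesis
  proof eventually_elim
    case (elim \<omega>)
    have "network_graph n (G n \<omega>)" if "1 \<le> n" for n
      by (rule network_graph_law) (use elim that in blast)
    moreover have "\<exists>S\<subseteq>{1..n}. G (Suc n) \<omega> = add_vertex n S (G n \<omega>)" if "1 \<le> n" for n
      by (rule set_attachment_step) (use elim that in blast)
    ultimately show ?case unfolding consistent_growth_def by blast
  qed
qed

lemma prob_exists_limit_le:
  assumes n: "n \<ge> 1" and bound: "\<And>N. n \<le> N \<Longrightarrow> prob {\<omega> \<in> space M. \<exists>t\<in>{n..N}. P \<omega> t (G t \<omega>)} \<le> b"
    and meas: "\<And>t. t \<ge> 1 \<Longrightarrow> {\<omega> \<in> space M. P \<omega> t (G t \<omega>)} \<in> events"
  shows "prob {\<omega> \<in> space M. \<exists>t\<ge>n. P \<omega> t (G t \<omega>)} \<le> b"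
proof -
  let ?A = "\<lambda>N. {\<omega> \<in> space M. \<exists>t\<in>{n..N}. P \<omega> t (G t \<omega>)}"
  have "?A N = (\<Union>t\<in>{n..N}. {\<omega> \<in> space M. P \<omega> t (G t \<omega>)})" for N by auto
  then have "?A N \<in> events" for N using n by (auto intro!: sets.finite_UN meas)
  moreover have "incseq ?A" by (intro incseq_SucI) auto
  ultimately have "(\<lambda>N. prob (?A N)) \<longlonglongrightarrow> prob (\<Union>N. ?A N)"
    by (intro finite_Lim_measure_incseq) auto
  moreover have "(\<Union>N. ?A N) = {\<omega> \<in> space M. \<exists>t\<ge>n. P \<omega> t (G t \<omega>)}"
    by (intro equalityI subsetI) (auto, meson atLeastAtMost_iff order_refl)
  ultimately have "(\<lambda>N. prob (?A N)) \<longlonglongrightarrow> prob {\<omega> \<in> space M. \<exists>t\<ge>n. P \<omega> t (G t \<omega>)}" by simp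
  then show ?thesis using bound by (intro LIMSEQ_le_const2) auto
qed

end

section \<open>Strong preference: the leader is eventually unique\<close>

locale attachment_model = attachment_network M f G + attachment f
  for M :: "'a measure" and f :: "nat \<Rightarrow> real" and G :: "nat \<Rightarrow> 'a \<Rightarrow> nat pair_pre_digraph"
begin

lemma prob_meet_after_le:
  assumes ij: "1 \<le> i" "i < j" "j \<le> n" and meet: "meeting f \<theta> k0"
  shows "prob {\<omega> \<in> space M. \<exists>t\<ge>n. indeg (G t \<omega>) i = indeg (G t \<omega>) j}
    \<le> measure_pmf.prob (graph_law f n) {H. indeg H i < k0}
      + measure_pmf.prob (graph_law f n) {H. indeg H j < k0} + 4 / \<theta>"
proof -
  interpret meeting f \<theta> k0 by (rule meet)
  have n: "1 \<le> n" using ij by simp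
  show ?thesis
  proof (rule prob_exists_limit_le[OF n])
    fix N assume nN: "n \<le> N"
    let ?R1 = "\<lambda>H. (k0 \<le> indeg_until n H i \<and> indeg_until n H i \<le> indeg_until n H j) \<and> degrees_meet i j n N H"
    let ?R2 = "\<lambda>H. (k0 \<le> indeg_until n H j \<and> indeg_until n H j < indeg_until n H i) \<and> degrees_meet i j n N H"
    let ?A = "{\<omega> \<in> space M. \<exists>t\<in>{n..N}. indeg (G t \<omega>) i = indeg (G t \<omega>) j}"
    let ?B1 = "{\<omega> \<in> space M. ?R1 (G N \<omega>)}" and ?B2 = "{\<omega> \<in> space M. ?R2 (G N \<omega>)}"
    let ?C1 = "{\<omega> \<in> space M. indeg (G n \<omega>) i < k0}" and ?C2 = "{\<omega> \<in> space M. indeg (G n \<omega>) j < k0}"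
    have ev: "?B1 \<in> events" "?B2 \<in> events" "?C1 \<in> events" "?C2 \<in> events"
      using n nN by (auto intro!: graph_event)
    have "prob ?A \<le> prob (?B1 \<union> (?B2 \<union> (?C1 \<union> ?C2)))"
    proof (rule finite_measure_mono_AE)
      show "AE \<omega> in M. \<omega> \<in> ?A \<longrightarrow> \<omega> \<in> ?B1 \<union> (?B2 \<union> (?C1 \<union> ?C2))"
        using AE_consistent_growth
      proof eventually_elim
        case (elim \<omega>)
        have "indeg_until t (G N \<omega>) m = indeg (G t \<omega>) m" if "t \<in> {n..N}" for t m
          using growth_indeg_until[OF elim, of t N m] that n by simp
        then show ?case using nN by (auto simp: degrees_meet_def)
      qed
    qed (use ev in auto)
    also have "\<dots> \<le> prob ?B1 + (prob ?B2 + (prob ?C1 + prob ?C2))"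
      using ev by (intro order.trans[OF measure_Un_le] add_mono order.refl) auto
    also have "prob ?B1 \<le> 2 / \<theta>"
      using prob_meet_late(1)[OF ij nN] n nN by (subst prob_graph) auto
    also have "prob ?B2 \<le> 2 / \<theta>"
      using prob_meet_late(2)[OF ij nN] n nN by (subst prob_graph) auto
    also have "prob ?C1 = measure_pmf.prob (graph_law f n) {H. indeg H i < k0}" by (rule prob_graph[OF n])
    also have "prob ?C2 = measure_pmf.prob (graph_law f n) {H. indeg H j < k0}" by (rule prob_graph[OF n])
    finally show "prob ?A \<le> measure_pmf.prob (graph_law f n) {H. indeg H i < k0}
      + measure_pmf.prob (graph_law f n) {H. indeg H j < k0} + 4 / \<theta>" by simp
  qed (rule graph_event)
qed

text \<open>
  Let first the time \<open>n\<close> and then \<open>\<theta>\<close> tend to infinity in \<open>prob_meet_after_le\<close>.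
\<close>

lemma AE_finitely_many_meetings:
  assumes sm: "summable (\<lambda>k. 1 / (f k)\<^sup>2)" and ij: "1 \<le> i" "i < j"
  shows "AE \<omega> in M. \<exists>T. \<forall>t\<ge>T. indeg (G t \<omega>) i \<noteq> indeg (G t \<omega>) j"
proof -
  let ?A = "\<lambda>n. {\<omega> \<in> space M. \<exists>t\<ge>n. indeg (G t \<omega>) i = indeg (G t \<omega>) j}"
  let ?B = "\<Inter>n\<in>{j..}. ?A n"
  have A_ev: "?A n \<in> events" if "n \<ge> 1" for n
  proof -
    have "?A n = (\<Union>t\<in>{n..}. {\<omega> \<in> space M. indeg (G t \<omega>) i = indeg (G t \<omega>) j})" by auto
    also have "\<dots> \<in> events" using that by (intro sets.countable_UN' graph_event) auto
    finally show ?thesis .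
  qed
  have B_ev: "?B \<in> events"
    using A_ev ij by (intro sets.countable_INT') auto
  have B_le: "prob ?B \<le> 4 / \<theta>" if \<theta>: "\<theta> > 0" for \<theta>
  proof -
    obtain k0 where meet: "meeting f \<theta> k0" using exists_meeting_level[OF sm \<theta>] by blast
    let ?c = "\<lambda>n. measure_pmf.prob (graph_law f n) {H. indeg H i < k0}
      + measure_pmf.prob (graph_law f n) {H. indeg H j < k0} + 4 / \<theta>"
    have "?c \<longlonglongrightarrow> 0 + 0 + 4 / \<theta>"
      using ij by (intro tendsto_add prob_low_degree_tendsto_0 tendsto_const) auto
    moreover have "prob ?B \<le> ?c n" if "j \<le> n" for n
    proof -
      have "prob ?B \<le> prob (?A n)" using that ij by (intro finite_measure_mono A_ev) auto
      also have "\<dots> \<le> ?c n" by (rule prob_meet_after_le[OF ij that meet])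
      finally show ?thesis .
    qed
    ultimately have "prob ?B \<le> 0 + 0 + 4 / \<theta>" by (intro LIMSEQ_le_const) auto
    then show ?thesis by simp
  qed
  have "prob ?B = 0"
  proof (rule ccontr)
    assume "prob ?B \<noteq> 0"
    then have pos: "prob ?B > 0" by (simp add: zero_less_measure_iff)
    then have "prob ?B \<le> prob ?B / 2" using B_le[of "8 / prob ?B"] by simp
    then show False using pos by simp
  qed
  then have "AE \<omega> in M. \<omega> \<notin> ?B" by (simp only: prob_eq_0[OF B_ev])
  moreover have "AE \<omega> in M. \<omega> \<in> space M" by (rule AE_space)
  ultimately show ?thesis by eventually_elim blast
qed

lemma AE_first_vertex_grows: "AE \<omega> in M. \<exists>s\<ge>2. k \<le> indeg (G s \<omega>) 1"
proof -
  let ?A = "\<lambda>s. {\<omega> \<in> space M. indeg (G s \<omega>) 1 < k}"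
  let ?B = "\<Inter>s\<in>{2..}. ?A s"
  have A_ev: "?A s \<in> events" if "2 \<le> s" for s using that by (intro graph_event) auto
  then have B_ev: "?B \<in> events" by (intro sets.countable_INT') auto
  have "prob ?B \<le> measure_pmf.prob (graph_law f s) {H. indeg H 1 < k}" if "2 \<le> s" for s
  proof -
    have "prob ?B \<le> prob (?A s)" using that A_ev by (intro finite_measure_mono) auto
    then show ?thesis using that by (subst prob_graph[symmetric]) auto
  qed
  then have "prob ?B \<le> 0"
    by (intro LIMSEQ_le_const[OF prob_low_degree_tendsto_0[of 1 k]]) auto
  then have "prob ?B = 0" by (simp add: measure_le_0_iff)
  then have "AE \<omega> in M. \<omega> \<notin> ?B" by (simp only: prob_eq_0[OF B_ev])
  moreover have "AE \<omega> in M. \<omega> \<in> space M" by (rule AE_space)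
  ultimately show ?thesis by eventually_elim (auto simp: not_less)
qed

text \<open>
  The bound for newcomers is available once vertex \<open>1\<close> has degree at least \<open>k0\<close> at some time \<open>s\<close>. For each
  \<open>s\<close> the Borel-Cantelli lemma applies on that event, and almost surely the event occurs for some \<open>s\<close>.
\<close>

lemma AE_newcomers_stay_below:
  assumes sm: "summable (\<lambda>k. 1 / (f k)\<^sup>2)"
  shows "AE \<omega> in M. \<exists>J. \<forall>j\<ge>J. \<forall>t\<ge>j. indeg (G t \<omega>) j \<noteq> indeg (G t \<omega>) 1"
proof -
  obtain k0 where meet: "meeting f 2 k0" using exists_meeting_level[OF sm, of 2] by auto
  interpret meeting f 2 k0 by (rule meet)
  have "AE \<omega> in M. \<forall>s. 2 \<le> s \<longrightarrow> k0 \<le> indeg (G s \<omega>) 1 \<longrightarrow>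
      (\<exists>J. \<forall>j\<ge>J. \<forall>t\<ge>j. indeg (G t \<omega>) j \<noteq> indeg (G t \<omega>) 1)"
    unfolding AE_all_countable
  proof
    fix s :: nat
    show "AE \<omega> in M. 2 \<le> s \<longrightarrow> k0 \<le> indeg (G s \<omega>) 1 \<longrightarrow>
      (\<exists>J. \<forall>j\<ge>J. \<forall>t\<ge>j. indeg (G t \<omega>) j \<noteq> indeg (G t \<omega>) 1)"
    proof (cases "2 \<le> s")
      case s: True
      let ?P = "\<lambda>j \<omega> t H. k0 \<le> indeg (G s \<omega>) 1 \<and> indeg H j = indeg H 1"
      let ?E = "\<lambda>j. {\<omega> \<in> space M. \<exists>t\<ge>j. ?P j \<omega> t (G t \<omega>)}"
      have P_ev: "{\<omega> \<in> space M. ?P j \<omega> t (G t \<omega>)} \<in> events" if "1 \<le> t" for j t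
        using that s by (intro sets.sets_Collect_conj graph_event) auto
      have E_ev: "?E j \<in> events" if "1 \<le> j" for j
      proof -
        have "?E j = (\<Union>t\<in>{j..}. {\<omega> \<in> space M. ?P j \<omega> t (G t \<omega>)})" by auto
        also have "\<dots> \<in> events" using that P_ev by (intro sets.countable_UN') auto
        finally show ?thesis .
      qed
      have E_le: "prob (?E j) \<le> 2 * (s / j)\<^sup>2" if j: "s \<le> j" for j
      proof (rule prob_exists_limit_le)
        show "1 \<le> j" using j s by simp
        fix N assume jN: "j \<le> N"
        let ?R = "\<lambda>H. k0 \<le> indeg_until s H 1 \<and> degrees_meet j 1 j N H"
        have "prob {\<omega> \<in> space M. \<exists>t\<in>{j..N}. ?P j \<omega> t (G t \<omega>)} \<le> prob {\<omega> \<in> space M. ?R (G N \<omega>)}"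
        proof (rule finite_measure_mono_AE)
          show "AE \<omega> in M. \<omega> \<in> {\<omega> \<in> space M. \<exists>t\<in>{j..N}. ?P j \<omega> t (G t \<omega>)} \<longrightarrow>
              \<omega> \<in> {\<omega> \<in> space M. ?R (G N \<omega>)}"
            using AE_consistent_growth
          proof eventually_elim
            case (elim \<omega>)
            have "indeg_until t (G N \<omega>) m = indeg (G t \<omega>) m" if "t \<in> {s..N}" for t m
              using growth_indeg_until[OF elim, of t N m] that s by simp
            then show ?case using j jN by (auto simp: degrees_meet_def)
          qed
        qed (use j jN s in \<open>auto intro!: graph_event\<close>)
        also have "\<dots> \<le> 2 * (s / j)\<^sup>2"
          using prob_newcomer_meets_le[OF refl s j jN] j jN s by (subst prob_graph) auto
        finally show "prob {\<omega> \<in> space M. \<exists>t\<in>{j..N}. ?P j \<omega> t (G t \<omega>)} \<le> 2 * (s / j)\<^sup>2" .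
      qed (rule P_ev)
      have "summable (\<lambda>j. 2 * (real s)\<^sup>2 * inverse (real j ^ 2))"
        by (intro summable_mult inverse_power_summable) simp
      then have "summable (\<lambda>j. 2 * (real s)\<^sup>2 * inverse (real (j + s) ^ 2))"
        by (subst summable_iff_shift[of "\<lambda>j. 2 * (real s)\<^sup>2 * inverse (real j ^ 2)" s])
      then have "summable (\<lambda>j. prob (?E (j + s)))"
      proof (rule summable_comparison_test')
        fix j :: nat
        show "norm (prob (?E (j + s))) \<le> 2 * (real s)\<^sup>2 * inverse (real (j + s) ^ 2)"
          using E_le[of "j + s"] by (simp add: divide_inverse power_mult_distrib power_inverse)
      qed
      then have "AE \<omega> in M. eventually (\<lambda>j. \<omega> \<in> space M - ?E (j + s)) sequentially"
        using E_ev s by (intro borel_cantelli_AE1) (auto simp: emeasure_eq_measure)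
      then show ?thesis
      proof eventually_elim
        case (elim \<omega>)
        then obtain J where J: "\<And>j. J \<le> j \<Longrightarrow> \<omega> \<in> space M - ?E (j + s)"
          by (auto simp: eventually_sequentially)
        have "indeg (G t \<omega>) j \<noteq> indeg (G t \<omega>) 1"
          if "k0 \<le> indeg (G s \<omega>) 1" "J + s \<le> j" "j \<le> t" for j t
          using J[of "j - s"] that by auto
        then show ?case by blast
      qed
    qed simp
  qed
  then show ?thesis using AE_first_vertex_grows[of k0] by eventually_elim blast
qed

theorem strong_preference_persistent_hub:
  assumes sm: "summable (\<lambda>k. 1 / (f k)\<^sup>2)"
  shows "AE \<omega> in M. \<exists>m. persistent_hub (\<lambda>n. G n \<omega>) m"
proof -
  have "AE \<omega> in M. \<forall>i j. 1 \<le> i \<longrightarrow> i < j \<longrightarrow> (\<exists>T. \<forall>t\<ge>T. indeg (G t \<omega>) i \<noteq> indeg (G t \<omega>) j)"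
    unfolding AE_all_countable
  proof (intro allI)
    fix i j
    show "AE \<omega> in M. 1 \<le> i \<longrightarrow> i < j \<longrightarrow> (\<exists>T. \<forall>t\<ge>T. indeg (G t \<omega>) i \<noteq> indeg (G t \<omega>) j)"
      using AE_finitely_many_meetings[OF sm, of i j] by (cases "1 \<le> i \<and> i < j") auto
  qed
  with AE_newcomers_stay_below[OF sm] AE_consistent_growth show ?thesis
  proof eventually_elim
    case (elim \<omega>)
    then obtain J where "\<And>j t. J \<le> j \<Longrightarrow> j \<le> t \<Longrightarrow> indeg (G t \<omega>) j \<noteq> indeg (G t \<omega>) 1" by blast
    with elim(2,3) show ?case by (intro persistent_hub_if_finitely_many_rivals[of _ J]) auto
  qed
qed

end

section \<open>Weak preference: the hub index diverges\<close>

locale weak_attachment_model = attachment_network M f G + weak_attachment f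
  for M :: "'a measure" and f :: "nat \<Rightarrow> real" and G :: "nat \<Rightarrow> 'a \<Rightarrow> nat pair_pre_digraph"
begin

lemma prob_is_hub_tendsto_0:
  assumes "1 \<le> m"
  shows "(\<lambda>n. prob {\<omega> \<in> space M. has_max_indegree (G n \<omega>) m}) \<longlonglongrightarrow> 0"
proof (rule Lim_transform_eventually[OF prob_max_indegree_tendsto_0[OF assms]])
  show "\<forall>\<^sub>F n in sequentially. measure_pmf.prob (graph_law f n) {H. has_max_indegree H m}
      = prob {\<omega> \<in> space M. has_max_indegree (G n \<omega>) m}"
    using eventually_ge_at_top[of 1] by eventually_elim (rule prob_graph[symmetric])
qed

lemma hub_is_vertex:
  assumes "consistent_growth g" "1 \<le> n" "has_max_indegree (g n) m"
  shows "1 \<le> m"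
  using growth_graph[OF assms(1,2)] assms(3) by (auto simp: network_graph_def has_max_indegree_def)

text \<open>
  A vertex that leads at all times from \<open>N\<close> on leads at each single time \<open>n \<ge> N\<close>, and the probability of
  this tends to \<open>0\<close>.
\<close>

theorem weak_preference_no_persistent_hub:
  "AE \<omega> in M. \<not> (\<exists>m. persistent_hub (\<lambda>n. G n \<omega>) m)"
proof -
  have "AE \<omega> in M. 1 \<le> m \<longrightarrow> \<not> (\<forall>n\<ge>Suc N. has_max_indegree (G n \<omega>) m)" for m N
  proof (cases "1 \<le> m")
    case m: True
    let ?B = "\<Inter>n\<in>{Suc N..}. {\<omega> \<in> space M. has_max_indegree (G n \<omega>) m}"
    have B_ev: "?B \<in> events" by (intro sets.countable_INT' graph_event) auto
    have "prob ?B \<le> prob {\<omega> \<in> space M. has_max_indegree (G n \<omega>) m}" if "Suc N \<le> n" for n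
      using that by (intro finite_measure_mono graph_event) auto
    then have "prob ?B \<le> 0"
      by (intro LIMSEQ_le_const[OF prob_is_hub_tendsto_0[OF m]]) auto
    then have "prob ?B = 0" by (simp add: measure_le_0_iff)
    then have "AE \<omega> in M. \<omega> \<notin> ?B" by (simp only: prob_eq_0[OF B_ev])
    moreover have "AE \<omega> in M. \<omega> \<in> space M" by (rule AE_space)
    ultimately show ?thesis by eventually_elim auto
  qed simp
  then have "AE \<omega> in M. \<forall>m N. 1 \<le> m \<longrightarrow> \<not> (\<forall>n\<ge>Suc N. has_max_indegree (G n \<omega>) m)"
    by (simp add: AE_all_countable)
  with AE_consistent_growth show ?thesis
  proof eventually_elim
    case (elim \<omega>)
    show ?case
    proof
      assume "\<exists>m. persistent_hub (\<lambda>n. G n \<omega>) m"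
      then obtain m N where mN: "\<And>n. N \<le> n \<Longrightarrow> has_max_indegree (G n \<omega>) m"
        by (auto simp: persistent_hub_def eventually_sequentially)
      have "1 \<le> m" using hub_is_vertex[OF elim(1), of "Suc N" m] mN[of "Suc N"] by simp
      then show False using elim(2) mN by (meson Suc_leD)
    qed
  qed
qed

theorem weak_preference_hub_index_diverges:
  assumes hub: "hub_selection hub"
  shows "tends_to_infinity_in_prob M (\<lambda>n \<omega>. hub (G n \<omega>))"
  unfolding tends_to_infinity_in_prob_def
proof
  fix K
  let ?A = "\<lambda>n m. {\<omega> \<in> space M. has_max_indegree (G n \<omega>) m}"
  have lower: "1 - (\<Sum>m\<in>{1..K}. prob (?A n m)) \<le> prob {\<omega> \<in> space M. K < hub (G n \<omega>)}" if n: "1 \<le> n" for n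
  proof -
    have ev: "{\<omega> \<in> space M. K < hub (G n \<omega>)} \<in> events" "?A n m \<in> events" for m
      using n by (auto intro!: graph_event)
    have "1 - prob {\<omega> \<in> space M. K < hub (G n \<omega>)} = prob {\<omega> \<in> space M. \<not> K < hub (G n \<omega>)}"
      using ev by (simp add: prob_neg)
    also have "\<dots> \<le> prob (\<Union>m\<in>{1..K}. ?A n m)"
    proof (rule finite_measure_mono_AE)
      show "AE \<omega> in M. \<omega> \<in> {\<omega> \<in> space M. \<not> K < hub (G n \<omega>)} \<longrightarrow> \<omega> \<in> (\<Union>m\<in>{1..K}. ?A n m)"
        using AE_consistent_growth
      proof eventually_elim
        case (elim \<omega>)
        have "pverts (G n \<omega>) = {1..n}"
          using growth_graph[OF elim n] by (simp add: network_graph_def)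
        then have "has_max_indegree (G n \<omega>) (hub (G n \<omega>))"
          using hub n by (simp add: hub_selection_def)
        moreover from this have "1 \<le> hub (G n \<omega>)" by (rule hub_is_vertex[OF elim n])
        ultimately show ?case by auto
      qed
    qed (use ev in auto)
    also have "\<dots> \<le> (\<Sum>m\<in>{1..K}. prob (?A n m))"
      using ev by (intro finite_measure_subadditive_finite) auto
    finally show ?thesis by simp
  qed
  have "(\<lambda>n. 1 - (\<Sum>m\<in>{1..K}. prob (?A n m))) \<longlonglongrightarrow> 1 - (\<Sum>m\<in>{1..K}. 0)"
    by (intro tendsto_intros prob_is_hub_tendsto_0) auto
  then have lim: "(\<lambda>n. 1 - (\<Sum>m\<in>{1..K}. prob (?A n m))) \<longlonglongrightarrow> 1" by simp
  show "(\<lambda>n. prob {\<omega> \<in> space M. K < hub (G n \<omega>)}) \<longlonglongrightarrow> 1"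
  proof (rule tendsto_sandwich[OF _ _ lim tendsto_const])
    show "\<forall>\<^sub>F n in sequentially. 1 - (\<Sum>m\<in>{1..K}. prob (?A n m)) \<le> prob {\<omega> \<in> space M. K < hub (G n \<omega>)}"
      using eventually_ge_at_top[of 1] by eventually_elim (rule lower)
  qed simp
qed

end

section \<open>The dichotomy\<close>

theorem theorem1p7:
  fixes M :: "'a measure" and f :: "nat \<Rightarrow> real"
    and G :: "nat \<Rightarrow> 'a \<Rightarrow> nat pair_pre_digraph"
    and hub :: "nat pair_pre_digraph \<Rightarrow> nat"
  assumes "attachment_rule f"
    and "concave_rule f"
    and "attachment_network M f G"
    and "hub_selection hub"
  shows "(summable (\<lambda>k. 1 / (f k)\<^sup>2) \<longrightarrow>
            (AE \<omega> in M. \<exists>m. persistent_hub (\<lambda>n. G n \<omega>) m)) \<and>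
         (\<not> summable (\<lambda>k. 1 / (f k)\<^sup>2) \<longrightarrow>
            (AE \<omega> in M. \<not> (\<exists>m. persistent_hub (\<lambda>n. G n \<omega>) m)) \<and>
            tends_to_infinity_in_prob M (\<lambda>n \<omega>. hub (G n \<omega>)))"
proof (intro conjI impI)
  assume "summable (\<lambda>k. 1 / (f k)\<^sup>2)"
  moreover have "attachment_model M f G"
    using assms by (simp add: attachment_model_def attachment_def)
  ultimately show "AE \<omega> in M. \<exists>m. persistent_hub (\<lambda>n. G n \<omega>) m"
    by (intro attachment_model.strong_preference_persistent_hub)
next
  assume "\<not> summable (\<lambda>k. 1 / (f k)\<^sup>2)"
  then have weak: "weak_attachment_model M f G"
    using assms by (simp add: weak_attachment_model_def weak_attachment_def
      weak_attachment_axioms_def attachment_def)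
  show "AE \<omega> in M. \<not> (\<exists>m. persistent_hub (\<lambda>n. G n \<omega>) m)"
    by (rule weak_attachment_model.weak_preference_no_persistent_hub[OF weak])
  show "tends_to_infinity_in_prob M (\<lambda>n \<omega>. hub (G n \<omega>))"
    by (rule weak_attachment_model.weak_preference_hub_index_diverges[OF weak assms(4)])
qed

end
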